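(* Let $(X,d)$ be a $\delta$-hyperbolic space and $a,b$ isometries of hyperbolic type such that $\langle a,b\rangle$ is a discrete, not virtually cyclic subgroup of $\operatorname{Isom}(X,d)$. Assume $L(a,b)>23\delta$. Then: (i) if $\ell(a),\ell(b)\le13\delta$, the subgroup generated by $\{a,b\}$ is free (freely generated by $a,b$); (ii) if $\ell(a),\ell(b)>13\delta$, one of the semigroups generated by $\{a,b\}$ or $\{a,b^{-1}\}$ is free; (iii) if $\ell(a)\le13\delta$ and $\ell(b)>13\delta$, one of the semigroups generated by $\{b,aba^{-1}\}$ or $\{b,ab^{-1}a^{-1}\}$ is free; (iv) if $\ell(a)>13\delta$ and $\ell(b)\le13\delta$, one of the semigroups generated by $\{a,bab^{-1}\}$ or $\{a,ba^{-1}b^{-1}\}$ is free.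
   Context: $L(a,b)$ (Margulis constant of the pair) is the infimum of $\max[d(x,a^px),d(x,b^qx)]$ over $x\in X$ and $(p,q)\in\mathbb Z^*\times\mathbb Z^*$ with $a^p,b^q$ nontrivial. $\ell(g)=\lim_k\frac1kd(x,g^kx)$; hyperbolic type means $\ell(g)>0$. $\delta$-hyperbolic: geodesic, proper, all geodesic triangles $\delta$-thin in the tripod sense (Gromov products $(y|z)_x=\frac12(d(x,y)+d(x,z)-d(y,z))$). Discrete: for the topology of uniform convergence on compacts. A semigroup generated by $\{u,v\}$ is free if distinct nonempty positive words in $u,v$ give distinct elements. *)

theory Defs
  imports "HOL-Analysis.Analysis"
begin

definition geodesic_path :: "(real \<Rightarrow> 'a::metric_space) \<Rightarrow> 'a \<Rightarrow> 'a \<Rightarrow> bool" where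
  "geodesic_path \<gamma> x y \<longleftrightarrow> \<gamma> 0 = x \<and> \<gamma> (dist x y) = y \<and>
     (\<forall>s\<in>{0..dist x y}. \<forall>t\<in>{0..dist x y}. dist (\<gamma> s) (\<gamma> t) = \<bar>s - t\<bar>)"

definition geodesic_space :: "'a::metric_space itself \<Rightarrow> bool" where
  "geodesic_space _ \<longleftrightarrow> (\<forall>x y::'a. \<exists>\<gamma>. geodesic_path \<gamma> x y)"

definition proper_space :: "'a::metric_space itself \<Rightarrow> bool" where
  "proper_space _ \<longleftrightarrow> (\<forall>(x::'a) r. compact (cball x r))"

definition gromov_prod :: "'a::metric_space \<Rightarrow> 'a \<Rightarrow> 'a \<Rightarrow> real" where
  "gromov_prod x y z = (dist x y + dist x z - dist y z) / 2"

text \<open>Tripod thinness: for every geodesic triangle and every vertex x, points on the two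
  sides issuing from x at equal distance t \<le> (y|z)_x from x are within delta.
  Quantifying over all ordered triples covers all three vertices of every triangle.\<close>
definition delta_hyperbolic :: "'a::metric_space itself \<Rightarrow> real \<Rightarrow> bool" where
  "delta_hyperbolic T \<delta> \<longleftrightarrow> geodesic_space T \<and> proper_space T \<and>
     (\<forall>(x::'a) y z \<gamma>1 \<gamma>2 \<gamma>3. geodesic_path \<gamma>1 x y \<and> geodesic_path \<gamma>2 x z \<and> geodesic_path \<gamma>3 y z \<longrightarrow>
        (\<forall>t. 0 \<le> t \<and> t \<le> gromov_prod x y z \<longrightarrow> dist (\<gamma>1 t) (\<gamma>2 t) \<le> \<delta>))"

definition isom :: "('a::metric_space \<Rightarrow> 'a) \<Rightarrow> bool" where
  "isom f \<longleftrightarrow> bij f \<and> (\<forall>x y. dist (f x) (f y) = dist x y)"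

definition zpow :: "('a \<Rightarrow> 'a) \<Rightarrow> int \<Rightarrow> 'a \<Rightarrow> 'a" where
  "zpow f p = (if p \<ge> 0 then f ^^ nat p else (inv f) ^^ nat (- p))"

text \<open>Translation length, computed at a fixed base point (it is independent of it).\<close>
definition translation_length :: "('a::metric_space \<Rightarrow> 'a) \<Rightarrow> real" where
  "translation_length g = lim (\<lambda>k. dist undefined ((g ^^ k) undefined) / real k)"

definition hyperbolic_type :: "('a::metric_space \<Rightarrow> 'a) \<Rightarrow> bool" where
  "hyperbolic_type g \<longleftrightarrow> translation_length g > 0"

definition margulis_const :: "('a::metric_space \<Rightarrow> 'a) \<Rightarrow> ('a \<Rightarrow> 'a) \<Rightarrow> real" where
  "margulis_const a b = Inf {max (dist x (zpow a p x)) (dist x (zpow b q x)) | x p q.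
      p \<noteq> 0 \<and> q \<noteq> 0 \<and> zpow a p \<noteq> id \<and> zpow b q \<noteq> id}"

inductive_set gen_group :: "('a \<Rightarrow> 'a) set \<Rightarrow> ('a \<Rightarrow> 'a) set" for S where
  gen_id: "id \<in> gen_group S"
| gen_gen: "s \<in> S \<Longrightarrow> s \<in> gen_group S"
| gen_inv: "s \<in> S \<Longrightarrow> inv s \<in> gen_group S"
| gen_comp: "g \<in> gen_group S \<Longrightarrow> h \<in> gen_group S \<Longrightarrow> g \<circ> h \<in> gen_group S"

text \<open>Discreteness for the topology of uniform convergence on compacts: every element is
  isolated, a basic neighbourhood of g being {h. \<forall>x\<in>K. dist (h x) (g x) < e}, K compact.\<close>
definition discrete_group :: "('a::metric_space \<Rightarrow> 'a) set \<Rightarrow> bool" where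
  "discrete_group G \<longleftrightarrow> (\<forall>g\<in>G. \<exists>K e. compact K \<and> e > 0 \<and>
      (\<forall>h\<in>G. (\<forall>x\<in>K. dist (h x) (g x) < e) \<longrightarrow> h = g))"

definition virtually_cyclic :: "('a \<Rightarrow> 'a) set \<Rightarrow> bool" where
  "virtually_cyclic G \<longleftrightarrow> (\<exists>c\<in>G. \<exists>F. finite F \<and> F \<subseteq> G \<and>
      G = (\<Union>f\<in>F. (\<lambda>h. f \<circ> h) ` range (zpow c)))"

definition letter_val :: "('a \<Rightarrow> 'a) \<Rightarrow> ('a \<Rightarrow> 'a) \<Rightarrow> bool \<times> bool \<Rightarrow> 'a \<Rightarrow> 'a" where
  "letter_val a b l = (let g = (if fst l then a else b) in if snd l then g else inv g)"

definition word_val :: "('a \<Rightarrow> 'a) \<Rightarrow> ('a \<Rightarrow> 'a) \<Rightarrow> (bool \<times> bool) list \<Rightarrow> 'a \<Rightarrow> 'a" where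
  "word_val a b w = foldr (\<lambda>l g. letter_val a b l \<circ> g) w id"

definition reduced_word :: "(bool \<times> bool) list \<Rightarrow> bool" where
  "reduced_word w \<longleftrightarrow> (\<forall>i. Suc i < length w \<longrightarrow>
      \<not> (fst (w ! i) = fst (w ! Suc i) \<and> snd (w ! i) \<noteq> snd (w ! Suc i)))"

definition freely_generates :: "('a \<Rightarrow> 'a) \<Rightarrow> ('a \<Rightarrow> 'a) \<Rightarrow> bool" where
  "freely_generates a b \<longleftrightarrow> (\<forall>w. w \<noteq> [] \<and> reduced_word w \<longrightarrow> word_val a b w \<noteq> id)"

definition pos_word_val :: "('a \<Rightarrow> 'a) \<Rightarrow> ('a \<Rightarrow> 'a) \<Rightarrow> bool list \<Rightarrow> 'a \<Rightarrow> 'a" where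
  "pos_word_val u v w = foldr (\<lambda>l g. (if l then u else v) \<circ> g) w id"

definition free_semigroup :: "('a \<Rightarrow> 'a) \<Rightarrow> ('a \<Rightarrow> 'a) \<Rightarrow> bool" where
  "free_semigroup u v \<longleftrightarrow> (\<forall>w1 w2. w1 \<noteq> [] \<and> w2 \<noteq> [] \<and> w1 \<noteq> w2 \<longrightarrow>
      pos_word_val u v w1 \<noteq> pos_word_val u v w2)"

end

theory Submission
  imports Defs
begin

text \<open>
  Thin triangles give the four-point inequality, and everything is done with Gromov products.
  If \<open>a\<close> and \<open>b\<close> have small translation length, the hypothesis on the Margulis constant
  provides a point \<open>x\<close>, on a geodesic between points hardly moved by \<open>a\<close> and by \<open>b\<close>, that
  every nontrivial power of \<open>a\<close> or \<open>b\<close> moves far away. Seen from \<open>x\<close>, all points \<open>a\<^sup>p x\<close> lie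
  in one direction and all \<open>b\<^sup>q x\<close> in the opposite one, and ping-pong applies. If both
  translation lengths are large, either the orbits of \<open>a\<close> and \<open>b\<close> diverge, and at a branch
  point of their axes three of the four pairs of directions are transverse, which makes a
  semigroup free; or they fellow-travel forever, and then discreteness forces a power of \<open>a\<close>
  to commute with \<open>b\<close>. A hyperbolic central element makes a discrete group virtually cyclic.
  The mixed cases apply the last dichotomy to \<open>b\<close> and \<open>a b a\<^sup>-\<^sup>1\<close>.
\<close>

section \<open>Isometries and translation lengths\<close>

text \<open>Neither a boundary at infinity nor axes are constructed. A single isometry enters
  through the distances inside its orbits, and points \<open>zpow g N y\<close> with
  \<open>N\<close> large stand for its ends. The obstacle is that a branch point depends on
  \<open>N\<close>, while \<open>N\<close> must be large compared with the distance to it; a bound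
  on that distance uniform in \<open>N\<close> breaks the circle. One local-to-global principle
  drives the growth estimates and both ping-pong arguments: if the distance from \<open>x0\<close>
  to \<open>x2\<close> exceeds both intermediate steps by more than 2\<delta>, then every point
  nearer to \<open>x2\<close> than to \<open>x1\<close> is farther from \<open>x0\<close> than from
  \<open>x1\<close>. The gap between 23 and 13 forces \<open>g x\<close> and \<open>inv g x\<close>
  into one direction when \<open>g\<close> is short but all its powers move \<open>x\<close> far. In
  the mixed cases the short isometry supplies no growth of its own; conjugating the long one by it
  yields a second isometry with the same large translation length.\<close>

lemma subadditive_div_tendsto:
  fixes f :: "nat \<Rightarrow> real"
  assumes sub: "\<And>m n. f (m + n) \<le> f m + f n" and nonneg: "\<And>n. 0 \<le> f n"
  shows "(\<lambda>n. f n / real n) \<longlonglongrightarrow> (INF n\<in>{1..}. f n / real n)"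
proof (rule LIMSEQ_I)
  fix e :: real assume e: "e > 0"
  define L where "L = (INF n\<in>{1..}. f n / real n)"
  have bdd: "bdd_below ((\<lambda>n. f n / real n) ` {1..})"
    by (rule bdd_belowI2[of _ 0]) (simp add: nonneg)
  have lb: "L \<le> f n / real n" if "n \<ge> 1" for n
    unfolding L_def by (rule cINF_lower[OF bdd]) (use that in auto)
  have "\<exists>N\<in>{1..}. f N / real N < L + e / 2"
    by (subst cINF_less_iff[OF _ bdd, symmetric]) (use e in \<open>auto simp: L_def\<close>)
  then obtain N where N: "N \<ge> 1" "f N / real N < L + e / 2" by auto
  \<comment> \<open>The classical argument for subadditive sequences: \<open>n\<close> is a multiple
    of \<open>N\<close> plus a remainder below \<open>N\<close>. \<open>M\<close> bounds the
    contribution of every remainder and vanishes after division by \<open>n\<close>.\<close>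
  define M where "M = (\<Sum>r<N. f r)"
  have M0: "M \<ge> 0" unfolding M_def by (intro sum_nonneg nonneg)
  have mult: "f (q * N + r) \<le> real q * f N + f r" for q r
  proof (induction q)
    case (Suc q)
    have "f (Suc q * N + r) = f (N + (q * N + r))" by (simp add: algebra_simps)
    also have "\<dots> \<le> f N + f (q * N + r)" by (rule sub)
    finally show ?case using Suc by (simp add: algebra_simps)
  qed simp
  have ub: "f n / real n \<le> f N / real N + M / real n" if n: "n \<ge> 1" for n
  proof -
    have "f n \<le> real (n div N) * f N + f (n mod N)"
      using mult[of "n div N" "n mod N"] by simp
    also have "f (n mod N) \<le> M" unfolding M_def
      by (rule member_le_sum) (use N nonneg in auto)
    also have "real (n div N) * f N \<le> (real n / real N) * f N"
      by (rule mult_right_mono[OF _ nonneg]) (simp add: of_nat_div_le_of_nat)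
    finally have "f n \<le> (real n / real N) * f N + M" by simp
    then have "f n / real n \<le> ((real n / real N) * f N + M) / real n"
      by (rule divide_right_mono) simp
    also have "\<dots> = f N / real N + M / real n" using n N by (simp add: field_simps)
    finally show ?thesis .
  qed
  obtain n0 :: nat where n0: "real n0 > 2 * M / e" using reals_Archimedean2 by blast
  show "\<exists>no. \<forall>n\<ge>no. norm (f n / real n - (INF n\<in>{1..}. f n / real n)) < e"
  proof (intro exI allI impI)
    fix n assume n: "n \<ge> max 1 n0"
    then have n1: "n \<ge> 1" and "real n > 2 * M / e" using n0 by (auto intro: less_le_trans)
    then have "M / real n < e / 2" using e n1 by (simp add: field_simps)
    then show "norm (f n / real n - (INF n\<in>{1..}. f n / real n)) < e"
      using ub[OF n1] lb[OF n1] N(2) unfolding L_def[symmetric] real_norm_def by linarith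
  qed
qed

section \<open>Isometries and their integer powers\<close>

lemma isom_bij: "isom f \<Longrightarrow> bij f"
  and isom_dist: "isom f \<Longrightarrow> dist (f x) (f y) = dist x y"
  by (auto simp: isom_def)

lemma isom_inv_f: "isom f \<Longrightarrow> inv f (f x) = x"
  and isom_f_inv: "isom f \<Longrightarrow> f (inv f x) = x"
  by (auto simp: isom_def bij_is_inj bij_is_surj surj_f_inv_f)

lemma isom_id: "isom id" by (simp add: isom_def)

lemma isom_comp: "isom f \<Longrightarrow> isom g \<Longrightarrow> isom (f \<circ> g)"
  by (auto simp: isom_def bij_comp)

lemma isom_inv: "isom f \<Longrightarrow> isom (inv f)"
  unfolding isom_def using bij_imp_bij_inv isom_f_inv[unfolded isom_def] by metis

lemma isom_comp_inv: "isom f \<Longrightarrow> f \<circ> inv f = id" "isom f \<Longrightarrow> inv f \<circ> f = id"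
  by (auto simp: fun_eq_iff isom_inv_f isom_f_inv)

lemma zpow_0 [simp]: "zpow f 0 = id" by (simp add: zpow_def)

lemma zpow_1 [simp]: "zpow f 1 = f" by (simp add: zpow_def)

lemma zpow_of_nat [simp]: "zpow f (int n) = f ^^ n" by (simp add: zpow_def)

lemma zpow_minus: "isom f \<Longrightarrow> zpow f (- p) = zpow (inv f) p"
  by (auto simp: zpow_def isom_bij inv_inv_eq)

lemma zpow_neg_1: "zpow f (- 1) = inv f" by (simp add: zpow_def)

lemma zpow_add_1: "isom f \<Longrightarrow> zpow f (p + 1) = f \<circ> zpow f p"
proof (cases "p \<ge> 0")
  case True
  then show ?thesis by (simp add: zpow_def nat_add_distrib)
next
  case False
  assume f: "isom f"
  define n where "n = nat (- p - 1)"
  have p: "p = - int (Suc n)" using False by (simp add: n_def)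
  have "zpow f p = inv f \<circ> zpow f (p + 1)"
    unfolding p using False by (auto simp: zpow_def nat_add_distrib)
  then show ?thesis using isom_comp_inv[OF f] by (metis comp_assoc id_comp)
qed

lemma zpow_add: "isom f \<Longrightarrow> zpow f (p + q) = zpow f p \<circ> zpow f q"
proof (induction p rule: int_induct[where k = 0])
  case (step1 i)
  have "zpow f (i + 1 + q) = zpow f ((i + q) + 1)" by (simp add: algebra_simps)
  then show ?case using step1 zpow_add_1 by (metis comp_assoc)
next
  case (step2 i)
  have "f \<circ> zpow f (i - 1 + q) = zpow f (i + q)"
    using zpow_add_1[of f "i - 1 + q"] step2 by (simp add: algebra_simps)
  also have "\<dots> = f \<circ> (zpow f (i - 1) \<circ> zpow f q)"
    using zpow_add_1[of f "i - 1"] step2 by (simp add: fun_eq_iff)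
  finally show ?case using isom_comp_inv(2)[OF step2(3)] by (metis comp_assoc id_comp)
qed simp

lemma zpow_add_apply: "isom f \<Longrightarrow> zpow f (p + q) x = zpow f p (zpow f q x)"
  by (simp add: zpow_add)

lemma isom_funpow: "isom f \<Longrightarrow> isom (f ^^ n)"
  by (induction n) (auto intro: isom_id isom_comp)

lemma isom_zpow: "isom f \<Longrightarrow> isom (zpow f p)"
  by (simp add: zpow_def isom_funpow isom_inv)

lemma zpow_commute_apply: "isom f \<Longrightarrow> zpow f p (zpow f q x) = zpow f q (zpow f p x)"
  by (metis add.commute zpow_add_apply)

lemma zpow_mult: "isom f \<Longrightarrow> zpow (zpow f p) q = zpow f (p * q)"
proof (induction q rule: int_induct[where k = 0])
  case (step1 i)
  then show ?case using zpow_add_1[OF isom_zpow, of f p i] zpow_add[of f p "p * i"]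
    by (simp add: algebra_simps)
next
  case (step2 i)
  have "zpow f p \<circ> zpow (zpow f p) (i - 1) = zpow f p \<circ> zpow f (p * (i - 1))"
    using zpow_add_1[OF isom_zpow, of f p "i - 1"] zpow_add[of f p "p * (i - 1)"] step2
    by (simp add: algebra_simps)
  then show ?case using isom_comp_inv(2)[OF isom_zpow[OF step2(3)]] by (metis comp_assoc id_comp)
qed simp

lemma zpow_commute:
  assumes f: "isom f" and gf: "g \<circ> f = f \<circ> g"
  shows "g \<circ> zpow f p = zpow f p \<circ> g"
proof (induction p rule: int_induct[where k = 0])
  case (step1 i)
  then show ?case by (metis zpow_add_1[OF f] comp_assoc gf)
next
  case (step2 i)
  have e: "zpow f i = f \<circ> zpow f (i - 1)" using zpow_add_1[OF f, of "i - 1"] by simp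
  have "f \<circ> (g \<circ> zpow f (i - 1)) = f \<circ> (zpow f (i - 1) \<circ> g)"
    using step2(2) unfolding e by (metis comp_assoc gf)
  then show ?case using isom_comp_inv(2)[OF f] by (metis comp_assoc id_comp)
qed simp

lemma zpow_conj:
  assumes h: "isom h" and f: "isom f"
  shows "zpow (h \<circ> f \<circ> inv h) p = h \<circ> zpow f p \<circ> inv h"
proof (induction p rule: int_induct[where k = 0])
  case base
  then show ?case by (simp add: isom_comp_inv[OF h])
next
  have i: "isom (h \<circ> f \<circ> inv h)" by (intro isom_comp isom_inv h f)
  {
    case (step1 q)
    then show ?case
      unfolding zpow_add_1[OF i] zpow_add_1[OF f] step1(2) by (simp add: fun_eq_iff isom_inv_f[OF h])
  next
    case (step2 q)
    have "zpow (h \<circ> f \<circ> inv h) (- 1 + q) = h \<circ> zpow f (- 1 + q) \<circ> inv h"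
      unfolding zpow_add[OF i] zpow_add[OF f] step2 zpow_neg_1
      using h f by (simp add: o_inv_distrib isom_bij bij_comp bij_imp_bij_inv inv_inv_eq
          fun_eq_iff isom_inv_f)
    then show ?case by (simp only: uminus_add_conv_diff)
  }
qed

section \<open>Displacement along orbits and its linear growth rate\<close>

definition disp :: "('a::metric_space \<Rightarrow> 'a) \<Rightarrow> 'a \<Rightarrow> int \<Rightarrow> real" where
  "disp g x p = dist x (zpow g p x)"

text \<open>Applying the isometry \<open>zpow g p\<close> shows that distances inside an orbit
  depend only on the difference of exponents. Computations with orbit points are thereby reduced to
  \<open>disp\<close>.\<close>

lemma dist_zpow:
  assumes "isom g"
  shows "dist (zpow g p x) (zpow g q x) = disp g x (q - p)"
proof -
  have "zpow g q x = zpow g p (zpow g (q - p) x)"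
    by (metis add_diff_eq add_diff_cancel_left' assms zpow_add_apply)
  then show ?thesis unfolding disp_def by (metis isom_dist[OF isom_zpow[OF assms]])
qed

lemma disp_0 [simp]: "disp g x 0 = 0" by (simp add: disp_def)

lemma disp_nonneg [simp]: "0 \<le> disp g x p" by (simp add: disp_def)

lemma disp_minus: "isom g \<Longrightarrow> disp g x (- p) = disp g x p"
  using dist_zpow[of g 0 x "-p"] dist_zpow[of g "-p" x 0] by (simp add: dist_commute)

lemma disp_add: "isom g \<Longrightarrow> disp g x (p + q) \<le> disp g x p + disp g x q"
  using dist_triangle[of x "zpow g (p + q) x" "zpow g p x"] dist_zpow[of g p x "p + q"]
  by (simp add: disp_def)

lemma disp_conj:
  "isom h \<Longrightarrow> isom g \<Longrightarrow> disp (h \<circ> g \<circ> inv h) (h x) p = disp g x p"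
  by (simp add: disp_def zpow_conj isom_inv_f isom_dist)

lemma disp_of_nat_le: "isom g \<Longrightarrow> disp g x (int n) \<le> real n * disp g x 1"
proof (induction n)
  case (Suc n)
  then show ?case using disp_add[of g x "int n" 1] by (simp add: algebra_simps)
qed simp

lemma translation_length_tendsto_base:
  assumes "isom g"
  shows "(\<lambda>k. disp g undefined (int k) / real k) \<longlonglongrightarrow> translation_length g"
proof -
  have *: "(\<lambda>k. disp g undefined (int k) / real k) \<longlonglongrightarrow>
      (INF n\<in>{1..}. disp g undefined (int n) / real n)"
    by (rule subadditive_div_tendsto) (use disp_add[OF assms] in auto)
  then have "translation_length g = (INF n\<in>{1..}. disp g undefined (int n) / real n)"
    unfolding translation_length_def using limI by (force simp: disp_def)
  with * show "(\<lambda>k. disp g undefined (int k) / real k) \<longlonglongrightarrow> translation_length g" by simp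
qed

lemma disp_base_change: "isom g \<Longrightarrow> \<bar>disp g x p - disp g y p\<bar> \<le> 2 * dist x y"
  using dist_triangle[of x "zpow g p x" y] dist_triangle[of y "zpow g p x" "zpow g p y"]
    dist_triangle[of y "zpow g p y" x] dist_triangle[of x "zpow g p y" "zpow g p x"]
    isom_dist[OF isom_zpow, of g p x y] isom_dist[OF isom_zpow, of g p y x]
  by (auto simp: disp_def dist_commute abs_le_iff)

text \<open>A change of base point alters every displacement by at most twice the distance of the
  two points, which dies after division by \<open>k\<close>. This frees the limit from the base
  point fixed in the definition.\<close>

lemma translation_length_tendsto:
  assumes "isom g"
  shows "(\<lambda>k. disp g x (int k) / real k) \<longlonglongrightarrow> translation_length g"
proof -
  have "(\<lambda>k. disp g x (int k) / real k - disp g undefined (int k) / real k) \<longlonglongrightarrow> 0"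
  proof (rule Lim_null_comparison)
    show "(\<lambda>k. (2 * dist x undefined) / real k) \<longlonglongrightarrow> 0"
      by (rule lim_const_over_n)
    show "\<forall>\<^sub>F k in sequentially. norm (disp g x (int k) / real k - disp g undefined (int k) / real k)
        \<le> 2 * dist x undefined / real k"
      by (rule always_eventually)
        (auto simp: diff_divide_distrib[symmetric] intro!: divide_right_mono disp_base_change assms)
  qed
  from tendsto_add[OF this translation_length_tendsto_base[OF assms]] show ?thesis by simp
qed

lemma translation_length_eqI:
  "isom g \<Longrightarrow> (\<lambda>k. disp g x (int k) / real k) \<longlonglongrightarrow> l \<Longrightarrow> translation_length g = l"
  using LIMSEQ_unique translation_length_tendsto by blast

text \<open>By subadditivity the limit is also the infimum of the quotients, so it bounds each of
  them from below.\<close>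

lemma translation_length_le_disp:
  assumes "isom g"
  shows "\<bar>real_of_int p\<bar> * translation_length g \<le> disp g x p"
proof -
  have *: "real n * translation_length g \<le> disp g x (int n)" if n: "n \<ge> 1" for n
  proof -
    have "(\<lambda>k. disp g x (int k) / real k) \<longlonglongrightarrow> (INF n\<in>{1..}. disp g x (int n) / real n)"
      by (rule subadditive_div_tendsto) (use disp_add[OF assms] in auto)
    then have "translation_length g = (INF n\<in>{1..}. disp g x (int n) / real n)"
      by (rule translation_length_eqI[OF assms])
    also have "\<dots> \<le> disp g x (int n) / real n"
      by (rule cINF_lower) (use n in \<open>auto intro!: bdd_belowI2[of _ 0]\<close>)
    finally show ?thesis using n by (simp add: field_simps)
  qed
  consider "p = 0" | "p > 0" | "p < 0" by linarith
  then show ?thesis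
  proof cases
    case 2
    then show ?thesis using *[of "nat p"] by simp
  next
    case 3
    then show ?thesis using *[of "nat (- p)"] by (simp add: disp_minus assms)
  qed simp
qed

lemma translation_length_nonneg: "isom g \<Longrightarrow> 0 \<le> translation_length g"
  by (rule LIMSEQ_le_const[OF translation_length_tendsto]) auto

lemma translation_length_le_of_bound:
  assumes "isom g" "\<And>n. disp g x (int n) \<le> real n * m + C"
  shows "translation_length g \<le> m"
proof (rule LIMSEQ_le[OF translation_length_tendsto[OF assms(1), of x]])
  have "(\<lambda>n. m + C / real n) \<longlonglongrightarrow> m + 0"
    by (intro tendsto_intros lim_const_over_n)
  then show "(\<lambda>n. m + C / real n) \<longlonglongrightarrow> m" by simp
  show "\<exists>N. \<forall>n\<ge>N. disp g x (int n) / real n \<le> m + C / real n"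
    by (rule exI[of _ 1]) (use assms(2) in \<open>auto simp: field_simps\<close>)
qed

lemma translation_length_ge_of_bound:
  assumes "isom g" "\<And>n. real n * m \<le> disp g x (int n)"
  shows "m \<le> translation_length g"
  by (rule LIMSEQ_le_const[OF translation_length_tendsto[OF assms(1), of x]])
    (rule exI[of _ 1], use assms(2) in \<open>auto simp: field_simps\<close>)

lemma translation_length_zpow:
  assumes g: "isom g"
  shows "translation_length (zpow g p) = \<bar>real_of_int p\<bar> * translation_length g"
proof (rule antisym)
  have d: "disp (zpow g p) x n = disp g x (p * n)" for x n
    by (simp add: disp_def zpow_mult g)
  show "\<bar>real_of_int p\<bar> * translation_length g \<le> translation_length (zpow g p)"
    by (rule translation_length_ge_of_bound[OF isom_zpow[OF g]])
      (use translation_length_le_disp[OF g, of "p * int _" undefined] in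
        \<open>simp add: d abs_mult mult.assoc mult.left_commute\<close>)
  show "translation_length (zpow g p) \<le> \<bar>real_of_int p\<bar> * translation_length g"
  proof (cases "p = 0")
    case True
    have "translation_length (zpow g p) \<le> 0"
      by (rule translation_length_le_of_bound[OF isom_zpow[OF g], where x = undefined and C = 0])
        (unfold d, simp add: True)
    then show ?thesis using True by simp
  next
    case False
    define q where "q = nat \<bar>p\<bar>"
    have q: "q > 0" "real q = \<bar>real_of_int p\<bar>" using False by (auto simp: q_def)
    have "disp (zpow g p) undefined (int n) = disp g undefined (int (q * n))" for n
      using disp_minus[OF g, of undefined "int (q * n)"] False
      by (cases "p \<ge> 0") (auto simp: d q_def)
    moreover have "(\<lambda>n. disp g undefined (int (q * n)) / real (q * n) * real q) \<longlonglongrightarrow>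
        translation_length g * real q"
      by (intro tendsto_mult tendsto_const)
        (rule LIMSEQ_subseq_LIMSEQ[OF translation_length_tendsto[OF g], of "\<lambda>n. q * n", unfolded o_def],
          use q in \<open>auto simp: strict_mono_def\<close>)
    ultimately have "(\<lambda>n. disp (zpow g p) undefined (int n) / real n) \<longlonglongrightarrow>
        translation_length g * real q"
      using q(1) by simp
    from translation_length_eqI[OF isom_zpow[OF g] this] show ?thesis using q by simp
  qed
qed

lemma translation_length_inv: "isom g \<Longrightarrow> translation_length (inv g) = translation_length g"
  using translation_length_zpow[of g "-1"] by (simp add: zpow_neg_1)

lemma translation_length_conj:
  assumes "isom h" "isom g"
  shows "translation_length (h \<circ> g \<circ> inv h) = translation_length g"
  by (rule translation_length_eqI[where x = "h undefined"])
    (auto simp: disp_conj assms intro!: isom_comp isom_inv translation_length_tendsto)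

lemma hyperbolic_zpow_neq_id:
  assumes "isom g" "hyperbolic_type g" "p \<noteq> 0"
  shows "zpow g p \<noteq> id"
proof
  assume "zpow g p = id"
  then have "disp g undefined p = 0" by (simp add: disp_def)
  with translation_length_le_disp[OF assms(1), of p undefined] assms(2,3) show False
    by (auto simp: hyperbolic_type_def mult_le_0_iff)
qed

section \<open>Gromov products and displacement of powers\<close>

lemma geodesic_path_reverse:
  assumes "geodesic_path \<gamma> x y"
  shows "geodesic_path (\<lambda>t. \<gamma> (dist x y - t)) y x"
  using assms by (auto simp: geodesic_path_def dist_commute[of y x])

lemma geodesic_path_image:
  assumes "geodesic_path \<gamma> x y" "isom g"
  shows "geodesic_path (g \<circ> \<gamma>) (g x) (g y)"
  using assms by (auto simp: geodesic_path_def isom_dist)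

lemma gromov_prod_commute: "gromov_prod x y z = gromov_prod x z y"
  by (simp add: gromov_prod_def dist_commute)

lemma gromov_prod_nonneg: "0 \<le> gromov_prod x y z"
  unfolding gromov_prod_def using dist_triangle[of y z x] by (simp add: dist_commute)

lemma gromov_prod_le: "gromov_prod x y z \<le> dist x y"
  unfolding gromov_prod_def using dist_triangle[of x z y] by simp

locale hyperbolic_space =
  fixes \<delta> :: real and X :: "'a::metric_space itself"
  assumes hyp: "delta_hyperbolic TYPE('a) \<delta>"
begin

lemma geodesic_exists: "\<exists>\<gamma>. geodesic_path \<gamma> x (y :: 'a)"
  using hyp by (auto simp: delta_hyperbolic_def geodesic_space_def)

lemma compact_cball_hyp: "compact (cball (x :: 'a) r)"
  using hyp by (auto simp: delta_hyperbolic_def proper_space_def)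

lemma thin:
  fixes x :: 'a
  assumes "geodesic_path \<gamma>1 x y" "geodesic_path \<gamma>2 x z" "0 \<le> t" "t \<le> gromov_prod x y z"
  shows "dist (\<gamma>1 t) (\<gamma>2 t) \<le> \<delta>"
proof -
  obtain \<gamma>3 where "geodesic_path \<gamma>3 y z" using geodesic_exists by blast
  then show ?thesis using hyp assms unfolding delta_hyperbolic_def by blast
qed

lemma delta_nonneg: "0 \<le> \<delta>"
proof -
  obtain \<gamma> where g: "geodesic_path \<gamma> undefined (undefined :: 'a)" using geodesic_exists by blast
  have "dist (\<gamma> 0) (\<gamma> 0) \<le> \<delta>" by (rule thin[OF g g]) (auto simp: gromov_prod_def)
  then show ?thesis by simp
qed

text \<open>The points at parameter \<open>t\<close> on three geodesics from \<open>w\<close> are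
  compared in turn. Two uses of thinness cost 2\<delta> in distance, hence only \<delta> in the
  product.\<close>

lemma gromov_prod_min:
  fixes w :: 'a
  shows "min (gromov_prod w x y) (gromov_prod w y z) - \<delta> \<le> gromov_prod w x z"
proof -
  obtain g1 where g1: "geodesic_path g1 w x" using geodesic_exists by blast
  obtain g2 where g2: "geodesic_path g2 w y" using geodesic_exists by blast
  obtain g3 where g3: "geodesic_path g3 w z" using geodesic_exists by blast
  define t where "t = min (gromov_prod w x y) (gromov_prod w y z)"
  have t: "0 \<le> t" "t \<le> gromov_prod w x y" "t \<le> gromov_prod w y z"
    unfolding t_def using gromov_prod_nonneg[of w] by auto
  have tx: "t \<le> dist w x" and tz: "t \<le> dist w z"
    using t gromov_prod_le[of w x y] gromov_prod_le[of w z y] by (auto simp: gromov_prod_commute)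
  have "dist (g1 t) (g2 t) \<le> \<delta>" by (rule thin[OF g1 g2 t(1,2)])
  moreover have "dist (g2 t) (g3 t) \<le> \<delta>" by (rule thin[OF g2 g3 t(1,3)])
  moreover have "dist x (g1 t) = dist w x - t" "dist (g3 t) z = dist w z - t"
    using g1 g3 t(1) tx tz unfolding geodesic_path_def
    by (metis abs_minus_commute abs_of_nonneg atLeastAtMost_iff diff_ge_0_iff_ge dist_commute
        order_refl zero_le_dist)+
  ultimately have "dist x z \<le> dist w x - t + 2 * \<delta> + (dist w z - t)"
    using dist_triangle[of x z "g1 t"] dist_triangle[of "g1 t" z "g3 t"]
      dist_triangle[of "g1 t" "g3 t" "g2 t"] by linarith
  then have "t - \<delta> \<le> gromov_prod w x z" by (simp add: gromov_prod_def)
  then show ?thesis by (simp add: t_def)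
qed

lemma four_point:
  fixes x :: 'a
  shows "dist x z + dist y w \<le> max (dist x y + dist z w) (dist x w + dist y z) + 2 * \<delta>"
  using gromov_prod_min[of x y z w] unfolding gromov_prod_def
  by (auto simp: dist_commute min_def max_def field_simps split: if_splits)

lemma point_on_segment:
  fixes x :: 'a
  assumes "0 \<le> t" "t \<le> dist x y"
  obtains m where "dist x m = t" "dist m y = dist x y - t"
proof -
  obtain g where g: "geodesic_path g x y" using geodesic_exists by blast
  then have "\<forall>s\<in>{0..dist x y}. \<forall>t\<in>{0..dist x y}. dist (g s) (g t) = \<bar>s - t\<bar>"
    by (simp add: geodesic_path_def)
  from bspec[OF bspec[OF this], of 0 t] bspec[OF bspec[OF this], of t "dist x y"]
  have "dist (g 0) (g t) = \<bar>0 - t\<bar>" "dist (g t) (g (dist x y)) = \<bar>t - dist x y\<bar>"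
    using assms by auto
  moreover have "g 0 = x" "g (dist x y) = y" using g by (auto simp: geodesic_path_def)
  ultimately show ?thesis using that[of "g t"] assms by simp
qed

text \<open>The witness is the point between \<open>p\<close> and \<open>q\<close> that corresponds
  to the branch point of the comparison tripod. Its product with \<open>p\<close>, \<open>q\<close>
  is 0, and the four-point inequality against \<open>r\<close> bounds the other two.\<close>

lemma center_exists:
  fixes p :: 'a
  obtains x where "gromov_prod x p q \<le> \<delta>" "gromov_prod x p r \<le> \<delta>" "gromov_prod x q r \<le> \<delta>"
proof -
  obtain x where x: "dist p x = gromov_prod p q r" "dist x q = dist p q - gromov_prod p q r"
    using point_on_segment[of "gromov_prod p q r" p q] gromov_prod_nonneg gromov_prod_le by metis
  show ?thesis
  proof (rule that[of x])
    show "gromov_prod x p q \<le> \<delta>"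
      using x delta_nonneg by (simp add: gromov_prod_def[of x p q] dist_commute[of x p])
    have "dist x r + dist p q \<le> (dist p q + dist p r + dist q r) / 2 + 2 * \<delta>"
      using four_point[of x r p q] x
      by (simp add: gromov_prod_def dist_commute field_simps)
    moreover have "2 * dist p x = dist p q + dist p r - dist q r"
      "2 * dist x q = dist p q - dist p r + dist q r"
      using x by (auto simp: gromov_prod_def field_simps)
    ultimately show "gromov_prod x p r \<le> \<delta>" "gromov_prod x q r \<le> \<delta>"
      by (simp_all add: gromov_prod_def dist_commute[of x p] field_simps)
  qed
qed

text \<open>The hypotheses exclude the alternative \<open>dist x0 x1 + dist x2 y\<close> in the
  four-point inequality. The conclusion implies \<open>dist x0 y > dist x1 y\<close>, which is the
  second hypothesis one step earlier in a chain, so the lemma can be iterated.\<close>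

lemma chain_step:
  fixes y :: 'a
  assumes "dist x0 x2 > max (dist x0 x1) (dist x1 x2) + 2 * \<delta>" "dist x1 y > dist x2 y"
  shows "dist x0 y \<ge> dist x1 y + dist x0 x2 - dist x1 x2 - 2 * \<delta>"
  using four_point[of x0 x2 x1 y] assms by (simp add: dist_commute max_def split: if_splits)

text \<open>\<open>chain_step\<close> is applied to \<open>x\<close>, its first two translates and a
  far orbit point. The strict clause is what the next application takes as its second
  hypothesis.\<close>

lemma disp_growth_of_double:
  fixes g :: "'a \<Rightarrow> 'a"
  assumes g: "isom g" and u: "disp g x 2 - disp g x 1 > 2 * \<delta>"
  shows "disp g x (int n + 1) \<ge> disp g x (int n) + (disp g x 2 - disp g x 1 - 2 * \<delta>)
    \<and> disp g x (int n + 1) > disp g x (int n)"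
proof (induction n)
  case 0
  have "disp g x 2 \<le> 2 * disp g x 1" using disp_add[OF g, of x 1 1] by simp
  then show ?case using u delta_nonneg by simp
next
  case (Suc n)
  have d: "dist x (zpow g (2 + int n) x) = disp g x (2 + int n)"
    "dist (zpow g 1 x) (zpow g (2 + int n) x) = disp g x (1 + int n)"
    "dist (zpow g 2 x) (zpow g (2 + int n) x) = disp g x (int n)"
    "dist x (zpow g 1 x) = disp g x 1"  "dist x (zpow g 2 x) = disp g x 2"
    "dist (zpow g 1 x) (zpow g 2 x) = disp g x 1"
    using dist_zpow[OF g, of 1 x 2] dist_zpow[OF g, of 1 x "2 + int n"]
      dist_zpow[OF g, of 2 x "2 + int n"]
    by (auto simp: disp_def simp del: zpow_1)
  have "max (dist x (zpow g 1 x)) (dist (zpow g 1 x) (zpow g 2 x)) + 2 * \<delta> < dist x (zpow g 2 x)"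
    "dist (zpow g 2 x) (zpow g (2 + int n) x) < dist (zpow g 1 x) (zpow g (2 + int n) x)"
    unfolding d using Suc u by (simp_all add: add.commute)
  from chain_step[OF this]
  have "disp g x (2 + int n) \<ge> disp g x (1 + int n) + disp g x 2 - disp g x 1 - 2 * \<delta>"
    unfolding d .
  then show ?case using u by (simp add: algebra_simps)
qed

text \<open>If the second step gained more than the translation length plus 2\<delta>, every later
  step would gain more than the translation length, against the limit.\<close>

lemma disp_2_le:
  fixes g :: "'a \<Rightarrow> 'a"
  assumes g: "isom g"
  shows "disp g x 2 \<le> disp g x 1 + translation_length g + 2 * \<delta>"
proof (cases "disp g x 2 - disp g x 1 > 2 * \<delta>")
  case True
  have "disp g x 2 - disp g x 1 - 2 * \<delta> \<le> translation_length g"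
  proof (rule translation_length_ge_of_bound[OF g])
    fix n
    show "real n * (disp g x 2 - disp g x 1 - 2 * \<delta>) \<le> disp g x (int n)"
    proof (induction n)
      case (Suc n)
      then show ?case using disp_growth_of_double[OF g True, of n]
        by (simp add: algebra_simps)
    qed simp
  qed
  then show ?thesis by simp
next
  case False
  then show ?thesis using translation_length_nonneg[OF g] by simp
qed

lemma disp_2_ge:
  fixes g :: "'a \<Rightarrow> 'a"
  assumes g: "isom g" and l: "translation_length g > \<delta>"
  shows "disp g x 2 \<ge> disp g x 1 + translation_length g - 2 * \<delta>"
proof (rule ccontr)
  \<comment> \<open>\<open>m\<close> bounds the average gain per step. The four-point inequality
    leaves two cases: one step gains at most the first entry, or two steps together gain at most
    2\<delta>, whence the entry \<delta>.\<close>
  define m where "m = max (disp g x 2 - disp g x 1 + 2 * \<delta>) \<delta>"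
  assume "\<not> ?thesis"
  then have lt: "m < translation_length g" using l by (auto simp: m_def)
  have m: "disp g x 2 - disp g x 1 + 2 * \<delta> \<le> m" "\<delta> \<le> m" by (auto simp: m_def)
  have "disp g x (int n) \<le> real n * m + disp g x 1 \<and>
      disp g x (int n + 1) \<le> real (Suc n) * m + disp g x 1" for n
  proof (induction n)
    case 0
    then show ?case using m delta_nonneg by simp
  next
    case (Suc n)
    have d: "dist x (zpow g (2 + int n) x) = disp g x (2 + int n)"
      "dist (zpow g 1 x) (zpow g (2 + int n) x) = disp g x (1 + int n)"
      "dist (zpow g 2 x) (zpow g (2 + int n) x) = disp g x (int n)"
      "dist x (zpow g 1 x) = disp g x 1"  "dist x (zpow g 2 x) = disp g x 2"
      "dist (zpow g 1 x) (zpow g 2 x) = disp g x 1"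
      using dist_zpow[OF g, of 1 x 2] dist_zpow[OF g, of 1 x "2 + int n"]
        dist_zpow[OF g, of 2 x "2 + int n"]
      by (auto simp: disp_def simp del: zpow_1)
    have "disp g x (2 + int n) + disp g x 1 \<le>
        max (disp g x 1 + disp g x (int n)) (disp g x 2 + disp g x (1 + int n)) + 2 * \<delta>"
      using four_point[of x "zpow g (2 + int n) x" "zpow g 1 x" "zpow g 2 x"]
      unfolding d by (simp add: d dist_commute)
    then show ?case using Suc m delta_nonneg
      by (auto simp: algebra_simps max_def split: if_splits)
  qed
  then have "translation_length g \<le> m"
    using translation_length_le_of_bound[OF g] by blast
  with lt show False by simp
qed

lemma disp_growth:
  fixes g :: "'a \<Rightarrow> 'a"
  assumes g: "isom g" and l: "translation_length g > 4 * \<delta>" and n: "n \<ge> 0"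
  shows "disp g x (n + 1) \<ge> disp g x n + translation_length g - 4 * \<delta>"
proof -
  have "translation_length g > \<delta>" using l delta_nonneg by linarith
  from disp_2_ge[OF g this, of x] l have "disp g x 2 - disp g x 1 > 2 * \<delta>" by linarith
  from disp_growth_of_double[OF g this, of "nat n"] \<open>disp g x 2 \<ge> _\<close> n show ?thesis by simp
qed

lemma gromov_prod_same_direction:
  fixes g :: "'a \<Rightarrow> 'a"
  assumes g: "isom g" and l: "translation_length g > 4 * \<delta>" and n: "n \<ge> 1"
  shows "gromov_prod x (g x) (zpow g n x) \<ge> (disp g x 1 + translation_length g - 4 * \<delta>) / 2"
proof -
  have "dist (g x) (zpow g n x) = disp g x (n - 1)" using dist_zpow[OF g, of 1 x n] by simp
  then have "gromov_prod x (g x) (zpow g n x) = (disp g x 1 + disp g x n - disp g x (n - 1)) / 2"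
    by (simp add: gromov_prod_def disp_def)
  then show ?thesis using disp_growth[OF g l, of "n - 1" x] n by simp
qed

lemma gromov_prod_inv:
  fixes g :: "'a \<Rightarrow> 'a"
  assumes g: "isom g"
  shows "gromov_prod x (g x) (inv g x) = disp g x 1 - disp g x 2 / 2"
  using dist_zpow[OF g, of "- 1" x 1] disp_minus[OF g, of x 1]
  by (simp add: gromov_prod_def zpow_neg_1 disp_def dist_commute field_simps)

text \<open>The forward point shares its direction with \<open>g x\<close>, the backward point with
  \<open>inv g x\<close>, and these two diverge. The lower bounds for sharing exceed the upper bound
  for diverging by the translation length minus 3\<delta>; two uses of
  \<open>gromov_prod_min\<close> need more than 2\<delta>, hence the threshold 5\<delta>.\<close>

lemma gromov_prod_opposite:
  fixes g :: "'a \<Rightarrow> 'a"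
  assumes g: "isom g" and l: "translation_length g > 5 * \<delta>" and ij: "i \<ge> 0" "j \<ge> 0"
  shows "gromov_prod x (zpow g i x) (zpow g (- j) x) \<le> disp g x 1 / 2 + 3 * \<delta>"
proof (cases "i = 0 \<or> j = 0")
  case True
  then have "gromov_prod x (zpow g i x) (zpow g (- j) x) = 0"
    by (auto simp: gromov_prod_def dist_commute)
  then show ?thesis using delta_nonneg by simp
next
  case False
  have l4: "translation_length g > 4 * \<delta>" "translation_length g > \<delta>" using l delta_nonneg by linarith+
  have li: "translation_length (inv g) = translation_length g" by (rule translation_length_inv[OF g])
  have di: "disp (inv g) x 1 = disp g x 1"
    using disp_minus[OF g, of x 1] zpow_minus[OF g, of 1] by (simp add: disp_def)
  have A: "gromov_prod x (g x) (zpow g i x) \<ge> (disp g x 1 + translation_length g - 4 * \<delta>) / 2"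
    by (rule gromov_prod_same_direction[OF g l4(1)]) (use ij False in auto)
  have B: "gromov_prod x (inv g x) (zpow g (- j) x) \<ge> (disp g x 1 + translation_length g - 4 * \<delta>) / 2"
    using gromov_prod_same_direction[OF isom_inv[OF g], of j x] ij False l4
    by (simp add: zpow_minus[OF g] li di)
  have C: "gromov_prod x (g x) (inv g x) \<le> (disp g x 1 - translation_length g + 2 * \<delta>) / 2"
    using gromov_prod_inv[OF g, of x] disp_2_ge[OF g l4(2), of x] by (simp add: field_simps)
  have "min (gromov_prod x (g x) (zpow g i x)) (gromov_prod x (zpow g i x) (inv g x)) - \<delta>
      \<le> gromov_prod x (g x) (inv g x)" by (rule gromov_prod_min)
  moreover have "min (gromov_prod x (zpow g i x) (zpow g (- j) x))
        (gromov_prod x (zpow g (- j) x) (inv g x)) - \<delta> \<le> gromov_prod x (zpow g i x) (inv g x)"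
    by (rule gromov_prod_min)
  ultimately show ?thesis using A B C l delta_nonneg
    by (auto simp: min_def gromov_prod_commute[of x "inv g x"] field_simps split: if_splits)
qed

end

section \<open>Small translation lengths\<close>

lemma margulis_const_le:
  assumes "isom a" "hyperbolic_type a" "isom b" "hyperbolic_type b" "p \<noteq> 0" "q \<noteq> 0"
  shows "margulis_const a b \<le> max (disp a x p) (disp b x q)"
  unfolding margulis_const_def disp_def
proof (rule cInf_lower)
  show "max (dist x (zpow a p x)) (dist x (zpow b q x)) \<in>
      {max (dist x (zpow a p x)) (dist x (zpow b q x)) |x p q.
        p \<noteq> 0 \<and> q \<noteq> 0 \<and> zpow a p \<noteq> id \<and> zpow b q \<noteq> id}"
    using assms hyperbolic_zpow_neq_id by blast
  show "bdd_below {max (dist x (zpow a p x)) (dist x (zpow b q x)) |x p q.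
        p \<noteq> 0 \<and> q \<noteq> 0 \<and> zpow a p \<noteq> id \<and> zpow b q \<noteq> id}"
    by (rule bdd_belowI[of _ 0]) (auto simp: le_max_iff_disj)
qed

lemma word_val_Cons: "word_val a b (l # w) = letter_val a b l \<circ> word_val a b w"
  by (simp add: word_val_def)

lemma reduced_word_ConsD: "reduced_word (l # w) \<Longrightarrow> reduced_word w"
  unfolding reduced_word_def by (metis Suc_mono length_Cons nth_Cons_Suc)

text \<open>The displacement by \<open>p\<close> is at least |p| times the translation length, so
  only finitely many \<open>p\<close> occur and the set is a finite union of closed sets.\<close>

lemma closed_displacement_le:
  fixes \<gamma> :: "real \<Rightarrow> 'a::metric_space"
  assumes g: "isom g" "hyperbolic_type g" and \<gamma>: "continuous_on {0..D} \<gamma>"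
  shows "closed {t \<in> {0..D}. \<exists>p. p \<noteq> 0 \<and> disp g (\<gamma> t) p \<le> R}"
proof -
  define l where "l = translation_length g"
  have l: "l > 0" using g by (simp add: hyperbolic_type_def l_def)
  define P where "P = {p::int. p \<noteq> 0 \<and> \<bar>p\<bar> \<le> \<lceil>R / l\<rceil>}"
  have "finite P" unfolding P_def by (rule finite_subset[of _ "{- \<lceil>R / l\<rceil>..\<lceil>R / l\<rceil>}"]) auto
  have "{t \<in> {0..D}. \<exists>p. p \<noteq> 0 \<and> disp g (\<gamma> t) p \<le> R} = (\<Union>p\<in>P. {t \<in> {0..D}. disp g (\<gamma> t) p \<le> R})"
  proof -
    have "p \<in> P" if "p \<noteq> 0" "disp g (\<gamma> t) p \<le> R" for t p
    proof -
      have "\<bar>real_of_int p\<bar> * l \<le> R"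
        using translation_length_le_disp[OF g(1), of p "\<gamma> t"] that(2) by (simp add: l_def)
      then have "\<bar>real_of_int p\<bar> \<le> R / l" using l by (simp add: field_simps)
      then have "real_of_int \<bar>p\<bar> \<le> real_of_int \<lceil>R / l\<rceil>" by linarith
      then have "\<bar>p\<bar> \<le> \<lceil>R / l\<rceil>" by (simp only: of_int_le_iff)
      then show ?thesis using that(1) by (simp add: P_def)
    qed
    then show ?thesis by (auto simp: P_def)
  qed
  moreover have "closed {t \<in> {0..D}. disp g (\<gamma> t) p \<le> R}" for p
  proof -
    have "continuous_on UNIV (zpow g p)"
      by (rule continuous_on_iff[THEN iffD2]) (use isom_dist[OF isom_zpow[OF g(1)]] in metis)
    then have "continuous_on {0..D} (\<lambda>t. disp g (\<gamma> t) p)" unfolding disp_def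
      by (intro continuous_on_dist \<gamma> continuous_on_compose2[OF _ \<gamma>]) auto
    then show ?thesis
      by (intro continuous_on_closed_Collect_le continuous_on_const) auto
  qed
  ultimately show ?thesis using \<open>finite P\<close> by auto
qed

section \<open>A point that all powers of both isometries move far\<close>

context hyperbolic_space
begin

text \<open>A geodesic from \<open>x0\<close> to \<open>y0\<close> is connected, and the two
  displacement sets on it are closed, disjoint and nonempty, so they do not cover it. A missed point
  lies between \<open>x0\<close> and \<open>y0\<close>, whence the product 0.\<close>

lemma segment_leaves_displacement_sets:
  fixes a b :: "'a \<Rightarrow> 'a"
  assumes a: "isom a" "hyperbolic_type a" and b: "isom b" "hyperbolic_type b"
    and disj: "\<And>x p q. p \<noteq> 0 \<Longrightarrow> q \<noteq> 0 \<Longrightarrow> R < max (disp a x p) (disp b x q)"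
    and x0: "disp a x0 1 \<le> R" and y0: "disp b y0 1 \<le> R"
  obtains x where "gromov_prod x x0 y0 = 0"
    "\<And>p. p \<noteq> 0 \<Longrightarrow> R < disp a x p" "\<And>p. p \<noteq> 0 \<Longrightarrow> R < disp b x p"
proof -
  obtain \<gamma> where \<gamma>: "geodesic_path \<gamma> x0 y0" using geodesic_exists by blast
  define D where "D = dist x0 y0"
  have iso: "dist (\<gamma> s) (\<gamma> t) = \<bar>s - t\<bar>" if "s \<in> {0..D}" "t \<in> {0..D}" for s t
    using \<gamma> that by (auto simp: geodesic_path_def D_def)
  have e: "\<gamma> 0 = x0" "\<gamma> D = y0" using \<gamma> by (auto simp: geodesic_path_def D_def)
  have "continuous_on {0..D} \<gamma>"
    unfolding continuous_on_iff by (metis iso dist_real_def)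
  note cl = closed_displacement_le[OF a this, of R] closed_displacement_le[OF b this, of R]
  define A where "A = {t \<in> {0..D}. \<exists>p. p \<noteq> 0 \<and> disp a (\<gamma> t) p \<le> R}"
  define B where "B = {t \<in> {0..D}. \<exists>p. p \<noteq> 0 \<and> disp b (\<gamma> t) p \<le> R}"
  have "A \<inter> B = {}"
  proof (rule ccontr)
    assume "A \<inter> B \<noteq> {}"
    then obtain t p q where "p \<noteq> 0" "q \<noteq> 0" "disp a (\<gamma> t) p \<le> R" "disp b (\<gamma> t) q \<le> R"
      by (auto simp: A_def B_def)
    with disj[of p q "\<gamma> t"] show False by simp
  qed
  moreover have "0 \<in> A \<inter> {0..D}" "D \<in> B \<inter> {0..D}" using e x0 y0 by (auto simp: A_def B_def D_def intro!: exI[of _ 1])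
  moreover have "connected {0..D}" by simp
  moreover have "closed A" "closed B" unfolding A_def B_def by (fact cl)+
  ultimately have "\<not> {0..D} \<subseteq> A \<union> B"
    unfolding connected_closed by (metis empty_iff inf_bot_left)
  then obtain t where t: "t \<in> {0..D}" "t \<notin> A" "t \<notin> B" by blast
  have D: "0 \<in> {0..D}" "D \<in> {0..D}" by (auto simp: D_def)
  have gp: "gromov_prod (\<gamma> t) x0 y0 = 0"
    using iso[OF t(1) D(1)] iso[OF t(1) D(2)] t(1)
    unfolding gromov_prod_def e D_def[symmetric] by simp
  show ?thesis
    by (rule that[OF gp]) (use t in \<open>auto simp: A_def B_def not_le\<close>)
qed

text \<open>The midpoint \<open>m\<close> of a geodesic from a base point \<open>o'\<close> to its
  image works. It and \<open>g m\<close> lie at equal distance from the vertex \<open>g o'\<close>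
  of the triangle \<open>o'\<close>, \<open>g o'\<close>, \<open>g (g o')\<close>: either both are
  in the thin leg there, or they are joined through the end of that leg.\<close>

lemma exists_small_displacement:
  fixes g :: "'a \<Rightarrow> 'a"
  assumes g: "isom g"
  obtains m where "disp g m 1 \<le> translation_length g + 3 * \<delta>"
proof -
  define o' where "o' = (undefined :: 'a)"
  obtain \<gamma> where \<gamma>: "geodesic_path \<gamma> o' (g o')" using geodesic_exists by blast
  define D where "D = dist o' (g o')"
  define m where "m = \<gamma> (D / 2)"
  have g1: "geodesic_path (\<lambda>t. \<gamma> (D - t)) (g o') o'"
    using geodesic_path_reverse[OF \<gamma>] by (simp add: D_def)
  have g2: "geodesic_path (g \<circ> \<gamma>) (g o') (g (g o'))" by (rule geodesic_path_image[OF \<gamma> g])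
  define t0 where "t0 = gromov_prod (g o') o' (g (g o'))"
  have d2: "dist o' (g (g o')) = disp g o' 2" "D = disp g o' 1"
    using zpow_add_apply[OF g, of 1 1 o'] by (simp_all add: disp_def D_def)
  have t0: "t0 = D - disp g o' 2 / 2"
    unfolding t0_def gromov_prod_def
    by (simp add: d2 isom_dist[OF g] dist_commute D_def[symmetric] field_simps)
  have t0n: "0 \<le> t0" unfolding t0_def by (rule gromov_prod_nonneg)
  have D0: "0 \<le> D" by (simp add: D_def)
  have iso: "\<And>s t. s \<in> {0..D} \<Longrightarrow> t \<in> {0..D} \<Longrightarrow> dist (\<gamma> s) (\<gamma> t) = \<bar>s - t\<bar>"
    using \<gamma> by (auto simp: geodesic_path_def D_def)
  have "dist m (g m) \<le> translation_length g + 3 * \<delta>"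
  proof (cases "D / 2 \<le> t0")
    case True
    have "dist (\<gamma> (D - D / 2)) ((g \<circ> \<gamma>) (D / 2)) \<le> \<delta>"
      by (rule thin[OF g1 g2]) (use True D0 in \<open>auto simp: t0_def\<close>)
    then show ?thesis using translation_length_nonneg[OF g] delta_nonneg by (simp add: m_def)
  next
    case False
    have "dist (\<gamma> (D - t0)) ((g \<circ> \<gamma>) t0) \<le> \<delta>"
      by (rule thin[OF g1 g2]) (use t0n in \<open>auto simp: t0_def\<close>)
    moreover have "dist m (\<gamma> (D - t0)) = D / 2 - t0"
      unfolding m_def using iso[of "D / 2" "D - t0"] False D0 t0n by simp
    moreover have "dist (g (\<gamma> t0)) (g m) = D / 2 - t0"
      unfolding m_def isom_dist[OF g] using iso[of t0 "D / 2"] False D0 t0n by simp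
    ultimately have "dist m (g m) \<le> D - 2 * t0 + \<delta>"
      using dist_triangle[of m "g m" "\<gamma> (D - t0)"]
        dist_triangle[of "\<gamma> (D - t0)" "g m" "g (\<gamma> t0)"] by simp
    also have "\<dots> \<le> translation_length g + 3 * \<delta>"
      using disp_2_le[OF g, of o'] t0 d2 by simp
    finally show ?thesis .
  qed
  then show ?thesis using that[of m] by (simp add: disp_def)
qed

text \<open>Otherwise the displacements by \<open>j - 1\<close> and \<open>j + 1\<close> would both be close to the sum of those
  by \<open>j\<close> and \<open>1\<close>, against the four-point inequality.\<close>
lemma powers_in_one_direction:
  fixes g :: "'a \<Rightarrow> 'a"
  assumes g: "isom g" and l: "translation_length g \<le> 13 * \<delta>"
    and big: "\<And>p. p \<noteq> 0 \<Longrightarrow> disp g x p > 23 * \<delta>" and j: "j \<noteq> 0"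
  shows "gromov_prod x (g x) (zpow g j x) > 3 * \<delta>"
proof (rule ccontr)
  assume "\<not> ?thesis"
  then have j1: "gromov_prod x (g x) (zpow g j x) \<le> 3 * \<delta>" by simp
  \<comment> \<open>The product is at least half of \<open>disp g x 1\<close> minus the translation
    length minus 2\<delta>, and (23 - 13 - 2)/2 = 4.\<close>
  have "gromov_prod x (g x) (inv g x) > 4 * \<delta>"
    unfolding gromov_prod_inv[OF g] using disp_2_le[OF g, of x] l big[of 1] by simp
  with gromov_prod_min[of x "g x" "inv g x" "zpow g j x"] j1
  have j2: "gromov_prod x (inv g x) (zpow g j x) \<le> 4 * \<delta>" by (auto simp: min_def split: if_splits)
  have d: "dist (g x) (zpow g j x) = disp g x (j - 1)" "dist (inv g x) (zpow g j x) = disp g x (j + 1)"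
    "dist x (inv g x) = disp g x 1"
    using dist_zpow[OF g, of 1 x j] dist_zpow[OF g, of "- 1" x j] disp_minus[OF g, of x 1]
    by (simp_all add: zpow_neg_1 disp_def)
  have a1: "disp g x (j - 1) \<ge> disp g x j + disp g x 1 - 6 * \<delta>"
    using j1 unfolding gromov_prod_def d by (simp add: disp_def)
  have a2: "disp g x (j + 1) \<ge> disp g x j + disp g x 1 - 8 * \<delta>"
    using j2 unfolding gromov_prod_def d by (simp add: disp_def)
  \<comment> \<open>The left side is at least twice \<open>disp g x j + disp g x 1\<close> minus
    14\<delta> by \<open>a1\<close> and \<open>a2\<close>, so the smaller of these two displacements
    would be at most 8\<delta>.\<close>
  have "disp g x (j + 1) + disp g x (j - 1) \<le> max (disp g x 1 + disp g x 1) (disp g x j + disp g x j) + 2 * \<delta>"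
    using four_point[of x "zpow g (j + 1) x" "g x" "zpow g j x"]
      dist_zpow[OF g, of j x "j + 1"] dist_zpow[OF g, of 1 x "j + 1"] d
    by (simp add: disp_def dist_commute max.commute)
  with a1 a2 big[of 1] big[OF j] show False using delta_nonneg
    by (auto simp: max_def split: if_splits)
qed

section \<open>Ping-pong with all powers of two isometries\<close>

definition cone :: "('a \<Rightarrow> 'a) \<Rightarrow> 'a \<Rightarrow> 'a set" where
  "cone g x = {y. \<exists>q. q \<noteq> 0 \<and> dist (zpow g q x) y < dist x y}"

text \<open>For \<open>y\<close> in the cone of \<open>t\<close>, \<open>chain_step\<close> applies
  to the chain \<open>x\<close>, \<open>zpow s p x\<close>, \<open>zpow s p (zpow t q x)\<close>,
  \<open>zpow s p y\<close>, so the last point is nearer to \<open>zpow s p x\<close> than to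
  \<open>x\<close>. The separation is used at exponent \<open>- p\<close> and transported by
  \<open>zpow s p\<close>.\<close>

lemma zpow_into_cone:
  fixes s t :: "'a \<Rightarrow> 'a"
  assumes s: "isom s"
    and sep: "\<And>p q. p \<noteq> 0 \<Longrightarrow> q \<noteq> 0 \<Longrightarrow>
      dist (zpow s p x) (zpow t q x) > max (disp s x p) (disp t x q) + 2 * \<delta>"
    and y: "y = x \<or> y \<in> cone t x" and p: "p \<noteq> 0"
  shows "zpow s p y \<in> cone s x"
proof -
  note iso = isom_dist[OF isom_zpow[OF s], of p]
  have "dist x y < dist x (zpow s p y)"
  proof (cases "y = x")
    case True
    have "dist x (zpow s p x) \<noteq> 0"
      using sep[OF p, of 1] delta_nonneg by (auto simp: disp_def)
    then show ?thesis using True zero_less_dist_iff[of x "zpow s p x"] by simp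
  next
    case False
    then obtain q where q: "q \<noteq> 0" "dist (zpow t q x) y < dist x y" using y by (auto simp: cone_def)
    have "dist (zpow s (- p) x) (zpow t q x) = dist x (zpow s p (zpow t q x))"
      using iso[of "zpow s (- p) x" "zpow t q x"] zpow_add_apply[OF s, of p "- p" x] by simp
    then have 1: "max (dist x (zpow s p x)) (dist (zpow s p x) (zpow s p (zpow t q x))) + 2 * \<delta>
        < dist x (zpow s p (zpow t q x))"
      using sep[of "- p" q] p q disp_minus[OF s, of x p] by (simp add: disp_def iso)
    have 2: "dist (zpow s p (zpow t q x)) (zpow s p y) < dist (zpow s p x) (zpow s p y)"
      using q by (simp add: iso)
    from chain_step[OF 1 2] 1 show ?thesis by (simp add: iso)
  qed
  then show ?thesis using p unfolding cone_def by (auto simp: iso intro!: exI[of _ p])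
qed

lemma freely_generates_of_separated:
  fixes a b :: "'a \<Rightarrow> 'a"
  assumes a: "isom a" and b: "isom b"
    and sep: "\<And>p q. p \<noteq> 0 \<Longrightarrow> q \<noteq> 0 \<Longrightarrow>
      dist (zpow a p x) (zpow b q x) > max (disp a x p) (disp b x q) + 2 * \<delta>"
  shows "freely_generates a b"
  unfolding freely_generates_def
proof (intro allI impI)
  define gen where "gen l = (if l then a else b)" for l
  have gen: "isom (gen l)" for l using a b by (simp add: gen_def)
  have into: "zpow (gen l) p y \<in> cone (gen l) x"
    if "y = x \<or> y \<in> cone (gen (\<not> l)) x" "p \<noteq> 0" for l p y
    by (rule zpow_into_cone[OF gen _ that])
      (use sep in \<open>auto simp: gen_def dist_commute max.commute\<close>)
  \<comment> \<open>Runs of one generator are merged: \<open>p\<close> is the exponent accumulated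
    in the leading run. Its sign is that of the leading letter because the word is reduced, so it
    never cancels to 0.\<close>
  have *: "\<exists>p y. p \<noteq> 0 \<and> (0 < p \<longleftrightarrow> snd (hd w)) \<and> word_val a b w x = zpow (gen (fst (hd w))) p y
      \<and> (y = x \<or> y \<in> cone (gen (\<not> fst (hd w))) x)"
    if "w \<noteq> []" "reduced_word w" for w
    using that
  proof (induction w)
    case (Cons l w)
    define e :: int where "e = (if snd l then 1 else - 1)"
    have lv: "letter_val a b l = zpow (gen (fst l)) e"
      by (auto simp: letter_val_def gen_def e_def zpow_neg_1)
    have e: "e \<noteq> 0" "0 < e \<longleftrightarrow> snd l" by (auto simp: e_def)
    show ?case
    proof (cases "w = []")
      case True
      then show ?thesis using e by (auto simp: word_val_Cons lv word_val_def intro!: exI[of _ e])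
    next
      case False
      from Cons.IH[OF this reduced_word_ConsD[OF Cons.prems(2)]] obtain p y
        where py: "p \<noteq> 0" "0 < p \<longleftrightarrow> snd (hd w)" "word_val a b w x = zpow (gen (fst (hd w))) p y"
          "y = x \<or> y \<in> cone (gen (\<not> fst (hd w))) x" by blast
      show ?thesis
      proof (cases "fst (hd w) = fst l")
        case True
        have "snd (hd w) = snd l"
          using Cons.prems(2)[unfolded reduced_word_def, rule_format, of 0] False True
          by (cases w) auto
        then have "e + p \<noteq> 0" "0 < e + p \<longleftrightarrow> snd l" using py e by (auto simp: e_def)
        then show ?thesis using py True
          by (intro exI[of _ "e + p"] exI[of _ y])
            (auto simp: word_val_Cons lv zpow_add_apply[OF gen])
      next
        case F: False
        then have "(\<not> fst l) = fst (hd w)" by auto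
        then have "word_val a b w x \<in> cone (gen (\<not> fst l)) x"
          using into[OF py(4) py(1)] py(3) by simp
        then show ?thesis using e
          by (intro exI[of _ e] exI[of _ "word_val a b w x"]) (auto simp: word_val_Cons lv)
      qed
    qed
  qed simp
  fix w assume "w \<noteq> [] \<and> reduced_word w"
  with *[of w] into have "word_val a b w x \<in> cone (gen (fst (hd w))) x" by metis
  then have "word_val a b w x \<noteq> x" by (auto simp: cone_def)
  then show "word_val a b w \<noteq> id" by auto
qed

lemma free_group_of_short_translation:
  fixes a b :: "'a \<Rightarrow> 'a"
  assumes a: "isom a" "hyperbolic_type a" "translation_length a \<le> 13 * \<delta>"
    and b: "isom b" "hyperbolic_type b" "translation_length b \<le> 13 * \<delta>"
    and L: "margulis_const a b > 23 * \<delta>"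
  shows "freely_generates a b"
proof -
  have \<delta>: "\<delta> > 0" using a by (simp add: hyperbolic_type_def)
  obtain x0 where "disp a x0 1 \<le> translation_length a + 3 * \<delta>"
    using exists_small_displacement[OF a(1)] .
  then have x0: "disp a x0 1 \<le> 16 * \<delta>" using a by simp
  obtain y0 where "disp b y0 1 \<le> translation_length b + 3 * \<delta>"
    using exists_small_displacement[OF b(1)] .
  then have y0: "disp b y0 1 \<le> 16 * \<delta>" using b by simp
  have "23 * \<delta> < max (disp a x p) (disp b x q)" if "p \<noteq> 0" "q \<noteq> 0" for x p q
    using margulis_const_le[OF a(1,2) b(1,2) that, of x] L by linarith
  moreover have "disp a x0 1 \<le> 23 * \<delta>" "disp b y0 1 \<le> 23 * \<delta>" using x0 y0 \<delta> by linarith+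
  ultimately obtain x where x: "gromov_prod x x0 y0 = 0"
    "\<And>p. p \<noteq> 0 \<Longrightarrow> 23 * \<delta> < disp a x p" "\<And>p. p \<noteq> 0 \<Longrightarrow> 23 * \<delta> < disp b x p"
    using segment_leaves_displacement_sets[OF a(1,2) b(1,2), of "23 * \<delta>" x0 y0] by metis
  \<comment> \<open>The point \<open>z0\<close>, hardly moved by \<open>g\<close>, marks the
    direction of the whole orbit. Its product with \<open>g x\<close> exceeds (23 - 16)/2 times
    \<delta>, where 16 = 13 + 3, and passing on to \<open>zpow g j x\<close> loses one
    \<delta>.\<close>
  have dir: "gromov_prod x z0 (zpow g j x) > 2 * \<delta>"
    if "isom g" "translation_length g \<le> 13 * \<delta>" "disp g z0 1 \<le> 16 * \<delta>"
      "\<And>p. p \<noteq> 0 \<Longrightarrow> 23 * \<delta> < disp g x p" "j \<noteq> 0" for g z0 j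
  proof -
    have "dist z0 (g x) \<le> disp g z0 1 + dist x z0"
      using dist_triangle[of z0 "g x" "g z0"] isom_dist[OF that(1), of z0 x]
      by (simp add: disp_def dist_commute)
    then have "gromov_prod x z0 (g x) > 3 * \<delta>"
      using that(3) that(4)[of 1] \<delta> by (simp add: gromov_prod_def disp_def)
    moreover have "gromov_prod x (g x) (zpow g j x) > 3 * \<delta>"
      using powers_in_one_direction[OF that(1,2,4,5)] .
    ultimately show ?thesis using gromov_prod_min[of x z0 "g x" "zpow g j x"]
      by (auto simp: min_def split: if_splits)
  qed
  show ?thesis
  proof (rule freely_generates_of_separated[OF a(1) b(1)])
    fix p q :: int assume pq: "p \<noteq> 0" "q \<noteq> 0"
    have A: "gromov_prod x x0 (zpow a p x) > 2 * \<delta>" by (rule dir[OF a(1,3) x0 x(2) pq(1)])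
    have B: "gromov_prod x y0 (zpow b q x) > 2 * \<delta>" by (rule dir[OF b(1,3) y0 x(3) pq(2)])
    \<comment> \<open>\<open>x0\<close> and \<open>y0\<close> have product 0 at \<open>x\<close>.
      Replacing \<open>y0\<close> by \<open>zpow b q x\<close> and then \<open>x0\<close> by
      \<open>zpow a p x\<close> costs one \<delta> each.\<close>
    have "gromov_prod x (zpow a p x) (zpow b q x) \<le> 2 * \<delta>"
      using A B x(1) gromov_prod_min[of x x0 "zpow a p x" "zpow b q x"]
        gromov_prod_min[of x x0 "zpow b q x" y0] gromov_prod_commute[of x y0] \<delta>
      by (auto simp: min_def split: if_splits)
    then show "max (disp a x p) (disp b x q) + 2 * \<delta> < dist (zpow a p x) (zpow b q x)"
      using x(2)[OF pq(1)] x(3)[OF pq(2)] \<delta> by (simp add: gromov_prod_def disp_def max_def)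
  qed
qed

end

section \<open>Free semigroups\<close>

lemma pos_word_val_Nil [simp]: "pos_word_val u v [] = id"
  by (simp add: pos_word_val_def)

lemma pos_word_val_Cons: "pos_word_val u v (l # w) = (if l then u else v) \<circ> pos_word_val u v w"
  by (simp add: pos_word_val_def)

lemma pos_word_val_append: "pos_word_val u v (w @ w') = pos_word_val u v w \<circ> pos_word_val u v w'"
  by (induction w) (auto simp: pos_word_val_Cons comp_assoc)

lemma bij_pos_word_val: "bij u \<Longrightarrow> bij v \<Longrightarrow> bij (pos_word_val u v w)"
  by (induction w) (auto simp: pos_word_val_Cons intro: bij_comp)

lemma pos_word_val_inv:
  assumes "bij u" "bij v"
  shows "pos_word_val (inv u) (inv v) w = inv (pos_word_val u v (rev w))"
proof (induction w)
  case (Cons l w)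
  define g where "g = (if l then u else v)"
  have "bij g" using assms by (simp add: g_def)
  then have "inv (pos_word_val u v (rev w) \<circ> g) = inv g \<circ> inv (pos_word_val u v (rev w))"
    by (intro o_inv_distrib bij_pos_word_val assms)
  moreover have "pos_word_val u v (rev (l # w)) = pos_word_val u v (rev w) \<circ> g"
    by (simp only: rev.simps pos_word_val_append pos_word_val_Cons pos_word_val_Nil comp_id g_def)
  moreover have "pos_word_val (inv u) (inv v) (l # w) = inv g \<circ> pos_word_val (inv u) (inv v) w"
    by (simp add: pos_word_val_Cons g_def)
  ultimately show ?case by (simp only: Cons)
qed simp

text \<open>Inversion reverses words without identifying any. This turns a result for
  \<open>inv a\<close>, \<open>b\<close> into one for \<open>a\<close>,
  \<open>inv b\<close>.\<close>

lemma free_semigroup_of_inv: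
  assumes "isom u" "isom v" "free_semigroup (inv u) (inv v)"
  shows "free_semigroup u v"
  unfolding free_semigroup_def
proof (intro allI impI notI)
  fix w1 w2 assume w: "w1 \<noteq> [] \<and> w2 \<noteq> [] \<and> w1 \<noteq> w2" "pos_word_val u v w1 = pos_word_val u v w2"
  then have "pos_word_val (inv u) (inv v) (rev w1) = pos_word_val (inv u) (inv v) (rev w2)"
    by (simp add: pos_word_val_inv isom_bij assms)
  then show False using assms(3) w(1) unfolding free_semigroup_def by (metis rev_is_Nil_conv rev_rev_ident)
qed

section \<open>Ping-pong with positive words\<close>

context hyperbolic_space
begin

text \<open>The conditions on two-letter words let \<open>chain_step\<close> carry to all lengths
  that a word sends \<open>x\<close> nearer to the image of \<open>x\<close> under its first letter
  than to \<open>x\<close>. By \<open>front\<close> the regions of the two letters are disjoint, so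
  the first letter can be read off and cancelled.\<close>

lemma pos_words_distinct:
  fixes u v :: "'a \<Rightarrow> 'a"
  assumes u: "isom u" and v: "isom v"
    and uu: "dist x (u (u x)) > dist x (u x) + 2 * \<delta>"
    and vv: "dist x (v (v x)) > dist x (v x) + 2 * \<delta>"
    and uv: "dist x (u (v x)) > max (dist x (u x)) (dist x (v x)) + 2 * \<delta>"
    and vu: "dist x (v (u x)) > max (dist x (u x)) (dist x (v x)) + 2 * \<delta>"
    and front: "dist (u x) (v x) > max (dist x (u x)) (dist x (v x)) + 2 * \<delta>"
  shows "free_semigroup u v"
proof -
  define gen where "gen l = (if l then u else v)" for l
  have iso: "dist (gen l y) (gen l z) = dist y z" for l y z
    using u v by (simp add: gen_def isom_dist)
  have gg: "dist x (gen l (gen k x)) > max (dist x (gen l x)) (dist x (gen k x)) + 2 * \<delta>" for l k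
    using uu vv uv vu by (auto simp: gen_def max.commute)
  have val: "pos_word_val u v (l # w) = gen l \<circ> pos_word_val u v w" for l w
    by (simp add: pos_word_val_Cons gen_def)
  have nearer: "dist (gen l x) (pos_word_val u v (l # w) x) < dist x (pos_word_val u v (l # w) x)" for l w
  proof (induction w arbitrary: l)
    case Nil
    have "dist x (gen l (gen l x)) \<le> 2 * dist x (gen l x)"
      using dist_triangle[of x "gen l (gen l x)" "gen l x"] by (simp add: iso)
    then have "dist x (gen l x) > 0" using gg[of l l] delta_nonneg unfolding max.idem by linarith
    then show ?case by (simp add: val)
  next
    case (Cons k w)
    define y where "y = pos_word_val u v (k # w) x"
    have 1: "max (dist x (gen l x)) (dist (gen l x) (gen l (gen k x))) + 2 * \<delta> < dist x (gen l (gen k x))"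
      using gg[of l k] by (simp add: iso)
    have 2: "dist (gen l (gen k x)) (gen l y) < dist (gen l x) (gen l y)"
      using Cons[of k] by (simp add: iso y_def)
    have "pos_word_val u v (l # k # w) x = gen l y" by (simp add: val y_def)
    then show ?case using chain_step[OF 1 2] 1 by simp
  qed
  have disjoint: "\<not> (dist (gen l x) y < dist x y \<and> dist (gen k x) y < dist x y)" if "l \<noteq> k" for l k y
  proof -
    have "dist (gen l x) (gen k x) > max (dist x (gen l x)) (dist x (gen k x)) + 2 * \<delta>"
      using front that by (cases l; cases k) (auto simp: gen_def dist_commute max.commute)
    then show ?thesis
      using four_point[of "gen l x" "gen k x" x y]
      by (auto simp: dist_commute max_def split: if_splits)
  qed
  have ne: "pos_word_val u v w1 \<noteq> pos_word_val u v w2" if "w1 \<noteq> w2" for w1 w2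
    using that
  proof (induction w1 arbitrary: w2)
    case Nil
    then obtain l w where "w2 = l # w" by (cases w2) auto
    then show ?case using nearer[of l w] by (metis dist_self id_apply pos_word_val_Nil not_less zero_le_dist)
  next
    case (Cons l w)
    show ?case
    proof (cases w2)
      case Nil
      then show ?thesis using nearer[of l w] by (metis dist_self id_apply pos_word_val_Nil not_less zero_le_dist)
    next
      case C2: (Cons k w')
      show ?thesis
      proof (cases "l = k")
        case True
        have "inj (gen l)" using u v by (simp add: gen_def isom_bij bij_is_inj)
        moreover have "pos_word_val u v w \<noteq> pos_word_val u v w'" using Cons C2 True by auto
        ultimately show ?thesis unfolding C2 True[symmetric] val
          by (metis fun.inj_map_strong inj_def comp_apply ext)
      next
        case False
        then show ?thesis
          using nearer[of l w] nearer[of k w'] disjoint unfolding C2 by metis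
      qed
    qed
  qed
  then show ?thesis by (simp add: free_semigroup_def)
qed

text \<open>The three products control the distance from \<open>u x\<close> to \<open>v x\<close>,
  the displacement of \<open>u \<circ> v\<close> and that of \<open>v \<circ> u\<close>, in this
  order. Each is at least a sum of two displacements minus 8\<delta>, and displacements above
  10\<delta> leave the margin 2\<delta>. The pair \<open>inv u x\<close>, \<open>inv v x\<close> is
  not compared by positive words.\<close>

lemma free_semigroup_of_small_products:
  fixes u v :: "'a \<Rightarrow> 'a"
  assumes u: "isom u" "translation_length u > 10 * \<delta>" and v: "isom v" "translation_length v > 10 * \<delta>"
    and p: "gromov_prod x (u x) (v x) \<le> 4 * \<delta>" "gromov_prod x (inv u x) (v x) \<le> 4 * \<delta>"
      "gromov_prod x (u x) (inv v x) \<le> 4 * \<delta>"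
  shows "free_semigroup u v"
proof -
  have sq: "dist x (g (g x)) > dist x (g x) + 2 * \<delta>" and far: "dist x (g x) > 10 * \<delta>"
    and inv: "dist x (inv g x) = dist x (g x)"
    if g: "isom g" "translation_length g > 10 * \<delta>" for g
  proof -
    have l: "translation_length g > \<delta>" "translation_length g - 2 * \<delta> > 2 * \<delta>"
      using g(2) delta_nonneg by linarith+
    show "dist x (g (g x)) > dist x (g x) + 2 * \<delta>"
      using disp_2_ge[OF g(1) l(1), of x] l(2) zpow_add_apply[OF g(1), of 1 1 x] by (simp add: disp_def)
    show "dist x (g x) > 10 * \<delta>"
      using translation_length_le_disp[OF g(1), of 1 x] g(2) by (simp add: disp_def)
    show "dist x (inv g x) = dist x (g x)"
      using disp_minus[OF g(1), of x 1] by (simp add: disp_def zpow_neg_1)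
  qed
  have d: "dist x (u (v x)) = dist (inv u x) (v x)" "dist x (v (u x)) = dist (u x) (inv v x)"
    using isom_dist[OF u(1), of "inv u x" "v x"] isom_dist[OF v(1), of "inv v x" "u x"]
    by (simp_all add: isom_f_inv u v dist_commute)
  note * = p far[OF u] far[OF v] inv[OF u] inv[OF v] d
  show ?thesis
    by (rule pos_words_distinct[OF u(1) v(1) sq[OF u] sq[OF v]])
      (use * in \<open>auto simp: gromov_prod_def max_def field_simps\<close>)
qed

text \<open>Seen from \<open>x\<close>, the point \<open>y\<close> lies in the direction of at most
  one of \<open>p\<close>, \<open>q\<close>, \<open>r\<close>, so the ways from \<open>y\<close> to
  the other two pass near \<open>x\<close>. The bound depends on the products alone: the triple may
  move off to infinity while its center stays near \<open>y\<close>.\<close>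

lemma dist_center_le:
  fixes x :: 'a
  assumes x: "gromov_prod x p q \<le> \<delta>" "gromov_prod x p r \<le> \<delta>" "gromov_prod x q r \<le> \<delta>"
    and y: "gromov_prod y p q \<le> M" "gromov_prod y p r \<le> M" "gromov_prod y q r \<le> M"
  shows "dist y x \<le> M + 4 * \<delta>"
proof -
  have two: "dist y x \<le> M + 4 * \<delta>"
    if "gromov_prod x y s \<le> 2 * \<delta>" "gromov_prod x y t \<le> 2 * \<delta>" "gromov_prod y s t \<le> M" for s t
  proof -
    have "dist y s + dist y t - dist s t \<le> 2 * M" using that(3) by (simp add: gromov_prod_def)
    moreover have "dist y s \<ge> dist y x + dist x s - 4 * \<delta>" "dist y t \<ge> dist y x + dist x t - 4 * \<delta>"
      using that(1,2) by (auto simp: gromov_prod_def dist_commute field_simps)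
    moreover have "dist s t \<le> dist x s + dist x t" using dist_triangle[of s t x] by (simp add: dist_commute)
    ultimately show ?thesis by simp
  qed
  have one: "gromov_prod x y s \<le> 2 * \<delta> \<or> gromov_prod x y t \<le> 2 * \<delta>" if "gromov_prod x s t \<le> \<delta>" for s t
    using gromov_prod_min[of x s y t] that gromov_prod_commute[of x y s]
    by (auto simp: min_def split: if_splits)
  from one[OF x(1)] one[OF x(2)] one[OF x(3)] two y show ?thesis by blast
qed

text \<open>By the length conditions, \<open>zpow k N y\<close> and \<open>zpow k N x\<close> lie in
  one direction from \<open>x\<close>, which is also that of \<open>k x\<close>. Replacing the two
  far points in the last hypothesis by \<open>g x\<close> and \<open>h x\<close> therefore costs one
  \<delta> each.\<close>

lemma gromov_prod_transfer:
  fixes g h :: "'a \<Rightarrow> 'a"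
  assumes g: "isom g" "translation_length g > 13 * \<delta>" and h: "isom h" "translation_length h > 13 * \<delta>"
    and N: "N \<ge> 1" "N * translation_length g > dist y x + 6 * \<delta>"
      "N * translation_length h > dist y x + 6 * \<delta>"
    and p: "gromov_prod x (zpow g N y) (zpow h N y) \<le> 2 * \<delta>"
  shows "gromov_prod x (g x) (h x) \<le> 4 * \<delta>"
proof -
  have *: "gromov_prod x (zpow k N y) (k x) > 4 * \<delta>"
    if k: "isom k" "translation_length k > 13 * \<delta>" "N * translation_length k > dist y x + 6 * \<delta>" for k
  proof -
    have l4: "translation_length k > 4 * \<delta>" using k(2) delta_nonneg by linarith
    have "gromov_prod x (k x) (zpow k N x) \<ge> (disp k x 1 + translation_length k - 4 * \<delta>) / 2"
      by (rule gromov_prod_same_direction[OF k(1) l4 N(1)])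
    moreover have "disp k x 1 \<ge> translation_length k"
      using translation_length_le_disp[OF k(1), of 1 x] by simp
    ultimately have 1: "gromov_prod x (k x) (zpow k N x) > 5 * \<delta>" using k(2) delta_nonneg by simp
    have "N * translation_length k \<le> dist x (zpow k N x)"
      using translation_length_le_disp[OF k(1), of N x] N(1) by (simp add: disp_def)
    moreover have "dist (zpow k N y) (zpow k N x) = dist y x" by (rule isom_dist[OF isom_zpow[OF k(1)]])
    moreover have "dist x (zpow k N x) \<le> dist x (zpow k N y) + dist (zpow k N y) (zpow k N x)"
      by (rule dist_triangle)
    ultimately have 2: "gromov_prod x (zpow k N y) (zpow k N x) > 6 * \<delta>"
      using k(3) by (simp add: gromov_prod_def)
    show ?thesis using 1 2 gromov_prod_min[of x "zpow k N y" "zpow k N x" "k x"] delta_nonneg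
      by (auto simp: gromov_prod_commute[of x "k x"] min_def split: if_splits)
  qed
  from *[OF g N(2)] *[OF h N(3)] p show ?thesis
    using gromov_prod_min[of x "zpow g N y" "g x" "zpow h N y"]
      gromov_prod_min[of x "g x" "h x" "zpow h N y"] gromov_prod_commute[of x "h x"] delta_nonneg
    by (auto simp: min_def split: if_splits)
qed

text \<open>At the center \<open>x\<close> of \<open>a\<^sup>N y\<close>, \<open>a\<^sup>-\<^sup>N y\<close>, \<open>b\<^sup>N y\<close> the point \<open>b\<^sup>-\<^sup>N y\<close> lies in the
  direction of at most one of \<open>a\<^sup>N y\<close>, \<open>a\<^sup>-\<^sup>N y\<close>; which one decides which semigroup is free.\<close>
lemma free_semigroup_of_bounded_products:
  fixes a b :: "'a \<Rightarrow> 'a"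
  assumes a: "isom a" "translation_length a > 13 * \<delta>" and b: "isom b" "translation_length b > 13 * \<delta>"
    and T: "\<And>n::int. n \<ge> 1 \<Longrightarrow> gromov_prod y (zpow a n y) (zpow b n y) \<le> T"
      "\<And>n::int. n \<ge> 1 \<Longrightarrow> gromov_prod y (zpow a (- n) y) (zpow b n y) \<le> T"
  shows "free_semigroup a b \<or> free_semigroup a (inv b)"
proof -
  define M where "M = max T (disp a y 1 / 2 + 3 * \<delta>)"
  define l where "l = min (translation_length a) (translation_length b)"
  have l: "l > 0" using a b delta_nonneg by (auto simp: l_def)
  \<comment> \<open>The exponent is fixed before the center, which depends on it.
    \<open>M + 4 * \<delta>\<close> will bound \<open>dist y x\<close> whatever the exponent, and
    \<open>gromov_prod_transfer\<close> asks for 6\<delta> more.\<close>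
  obtain n :: nat where n: "real n > (M + 10 * \<delta>) / l" using reals_Archimedean2 by blast
  define N where "N = int (Suc n)"
  have N: "N \<ge> 1" by (simp add: N_def)
  have "real_of_int N > (M + 10 * \<delta>) / l" using n by (simp add: N_def)
  then have Nl: "N * l > M + 10 * \<delta>" using l by (simp add: field_simps)
  have "N * l \<le> N * translation_length a" "N * l \<le> N * translation_length b"
    using N by (auto intro!: mult_left_mono simp: l_def)
  with Nl have Nab: "N * translation_length a > M + 10 * \<delta>" "N * translation_length b > M + 10 * \<delta>"
    by linarith+
  obtain x where x: "gromov_prod x (zpow a N y) (zpow a (- N) y) \<le> \<delta>"
    "gromov_prod x (zpow a N y) (zpow b N y) \<le> \<delta>" "gromov_prod x (zpow a (- N) y) (zpow b N y) \<le> \<delta>"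
    by (rule center_exists)
  have a5: "translation_length a > 5 * \<delta>" using a(2) delta_nonneg by linarith
  have "dist y x \<le> M + 4 * \<delta>"
    by (rule dist_center_le[OF x])
      (use T[OF N] gromov_prod_opposite[OF a(1) a5, of N N y] N in \<open>auto simp: M_def le_max_iff_disj\<close>)
  then have Nx: "N * translation_length a > dist y x + 6 * \<delta>" "N * translation_length b > dist y x + 6 * \<delta>"
    using Nab by linarith+
  have ia: "isom (inv a)" "translation_length (inv a) > 13 * \<delta>"
      "N * translation_length (inv a) > dist y x + 6 * \<delta>" "zpow (inv a) N = zpow a (- N)"
    using a Nx by (simp_all add: isom_inv translation_length_inv zpow_minus)
  have ib: "isom (inv b)" "translation_length (inv b) > 13 * \<delta>"
      "N * translation_length (inv b) > dist y x + 6 * \<delta>" "zpow (inv b) N = zpow b (- N)"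
    using b Nx by (simp_all add: isom_inv translation_length_inv zpow_minus)
  have ab: "gromov_prod x (a x) (b x) \<le> 4 * \<delta>"
    by (rule gromov_prod_transfer[OF a b N Nx]) (use x delta_nonneg in linarith)
  have iab: "gromov_prod x (inv a x) (b x) \<le> 4 * \<delta>"
    by (rule gromov_prod_transfer[OF ia(1,2) b N ia(3) Nx(2)]) (use x delta_nonneg ia(4) in simp)
  have lengths: "translation_length a > 10 * \<delta>" "translation_length b > 10 * \<delta>"
    "translation_length (inv a) > 10 * \<delta>"
    using a(2) b(2) ia(2) delta_nonneg by linarith+
  consider "gromov_prod x (zpow a N y) (zpow b (- N) y) \<le> 2 * \<delta>"
    | "gromov_prod x (zpow a (- N) y) (zpow b (- N) y) \<le> 2 * \<delta>"
    using x(1) gromov_prod_min[of x "zpow a N y" "zpow b (- N) y" "zpow a (- N) y"]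
      gromov_prod_commute[of x "zpow b (- N) y"]
    by (auto simp: min_def split: if_splits)
  then show ?thesis
  proof cases
    case 1
    have "gromov_prod x (a x) (inv b x) \<le> 4 * \<delta>"
      by (rule gromov_prod_transfer[OF a ib(1,2) N Nx(1) ib(3)]) (use 1 ib(4) in simp)
    then have "free_semigroup a b"
      using free_semigroup_of_small_products[OF a(1) lengths(1) b(1) lengths(2) ab iab] by simp
    then show ?thesis ..
  next
    case 2
    have "gromov_prod x (inv a x) (inv b x) \<le> 4 * \<delta>"
      by (rule gromov_prod_transfer[OF ia(1,2) ib(1,2) N ia(3) ib(3)]) (use 2 ia(4) ib(4) in simp)
    then have "free_semigroup (inv a) b"
      using free_semigroup_of_small_products[OF ia(1) lengths(3) b(1) lengths(2) iab] ab a(1)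
      by (simp add: inv_inv_eq isom_bij)
    then have "free_semigroup (inv a) (inv (inv b))" using b(1) by (simp add: inv_inv_eq isom_bij)
    then show ?thesis using free_semigroup_of_inv[OF a(1) ib(1)] by simp
  qed
qed

end

section \<open>Discrete groups\<close>

lemma inv_comp_isom: "isom g \<Longrightarrow> isom h \<Longrightarrow> inv (g \<circ> h) = inv h \<circ> inv g"
  by (simp add: o_inv_distrib isom_bij)

lemma gen_group_isom:
  assumes "\<And>s. s \<in> S \<Longrightarrow> isom s" "g \<in> gen_group S"
  shows "isom g"
  using assms(2) by induction (simp_all only: isom_id isom_inv isom_comp assms(1))

lemma gen_group_inv:
  assumes "\<And>s. s \<in> S \<Longrightarrow> isom s" "g \<in> gen_group S"
  shows "inv g \<in> gen_group S"
  using assms(2)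
proof induction
  case (gen_inv s)
  then show ?case using assms(1) by (simp add: inv_inv_eq isom_bij gen_group.gen_gen)
next
  case (gen_comp g h)
  have "isom g" "isom h" using gen_group_isom[OF assms(1)] gen_comp by blast+
  then have "inv (g \<circ> h) = inv h \<circ> inv g" by (rule inv_comp_isom)
  then show ?case using gen_comp.IH by (simp only: gen_group.gen_comp)
qed (simp_all only: inv_id gen_group.intros)

lemma commute_inv:
  assumes "isom s" "c \<circ> s = s \<circ> c"
  shows "c \<circ> inv s = inv s \<circ> c"
proof
  fix z
  have "s (c (inv s z)) = c z" using fun_cong[OF assms(2), of "inv s z"] by (simp add: isom_f_inv assms(1))
  then show "(c \<circ> inv s) z = (inv s \<circ> c) z" using isom_inv_f[OF assms(1), of "c (inv s z)"] by simp
qed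

lemma gen_group_commute:
  assumes "\<And>s. s \<in> S \<Longrightarrow> isom s" "\<And>s. s \<in> S \<Longrightarrow> c \<circ> s = s \<circ> c" "g \<in> gen_group S"
  shows "c \<circ> g = g \<circ> c"
  using assms(3)
proof induction
  case (gen_inv s)
  then show ?case using commute_inv assms(1,2) by blast
next
  case (gen_comp g h)
  then show ?case by (metis comp_assoc)
qed (auto simp: assms)

lemma finite_range_nat_collision:
  fixes \<phi> :: "nat \<Rightarrow> 'b"
  assumes "finite S" "range \<phi> \<subseteq> S"
  obtains i j where "i < j" "\<phi> i = \<phi> j"
proof -
  have "\<not> inj \<phi>" using assms by (meson finite_subset range_inj_infinite)
  then obtain i j where "i \<noteq> j" "\<phi> i = \<phi> j" by (auto simp: inj_def)
  then show ?thesis using that[of i j] that[of j i] by (cases "i < j") auto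
qed

locale discrete_isometry_group = hyperbolic_space \<delta> X for \<delta> and X :: "'a::metric_space itself" +
  fixes G :: "('a \<Rightarrow> 'a) set"
  assumes isomG: "g \<in> G \<Longrightarrow> isom g"
    and idG: "id \<in> G"
    and compG: "g \<in> G \<Longrightarrow> h \<in> G \<Longrightarrow> g \<circ> h \<in> G"
    and invG: "g \<in> G \<Longrightarrow> inv g \<in> G"
    and discG: "discrete_group G"
begin

lemma zpowG: "g \<in> G \<Longrightarrow> zpow g p \<in> G"
proof -
  have "h ^^ n \<in> G" if "h \<in> G" for h and n :: nat
    by (induction n) (simp_all only: funpow.simps idG compG that)
  then show "g \<in> G \<Longrightarrow> zpow g p \<in> G" by (simp add: zpow_def invG)
qed

text \<open>An element is determined by its approximate values on a finite net of the compact set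
  that isolates the identity.\<close>
lemma finite_bounded_displacement: "finite {g \<in> G. dist x (g x) \<le> r}"
proof -
  obtain K e where K: "compact K" "e > 0"
    "\<And>h. h \<in> G \<Longrightarrow> (\<forall>y\<in>K. dist (h y) (id y) < e) \<Longrightarrow> h = id"
    using discG idG unfolding discrete_group_def by meson
  obtain N where N: "finite N" "K \<subseteq> (\<Union>p\<in>N. ball p (e / 3))"
    using K(1,2) unfolding compact_eq_totally_bounded by (meson zero_less_divide_iff zero_less_numeral)
  define R where "R = r + (\<Sum>p\<in>N. dist x p)"
  obtain M where M: "finite M" "cball x R \<subseteq> (\<Union>q\<in>M. ball q (e / 6))"
    using compact_cball_hyp[of x R] K(2) unfolding compact_eq_totally_bounded
    by (meson zero_less_divide_iff zero_less_numeral)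
  define H where "H = {g \<in> G. dist x (g x) \<le> r}"
  have near: "\<exists>q\<in>M. dist q (g p) < e / 6" if "g \<in> H" "p \<in> N" for g p
  proof -
    have "dist x (g p) \<le> dist x (g x) + dist (g x) (g p)" by (rule dist_triangle)
    also have "\<dots> \<le> r + dist x p" using that isomG by (auto simp: H_def isom_dist)
    also have "dist x p \<le> (\<Sum>p\<in>N. dist x p)" by (rule member_le_sum) (use that N in auto)
    finally have "g p \<in> cball x R" by (simp add: R_def)
    then have "g p \<in> (\<Union>q\<in>M. ball q (e / 6))" using M(2) by blast
    then show ?thesis by (simp only: UN_iff mem_ball)
  qed
  \<comment> \<open>Elements with the same record differ by less than e/3 on the net
    \<open>N\<close> of \<open>K\<close>, and passing between a point of \<open>K\<close> and
    \<open>N\<close> adds e/3 for each of the two maps: the total stays below the isolating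
    \<open>e\<close>.\<close>
  define \<phi> where "\<phi> g = (\<lambda>p\<in>N. SOME q. q \<in> M \<and> dist q (g p) < e / 6)" for g :: "'a \<Rightarrow> 'a"
  have \<phi>: "\<phi> g p \<in> M" "dist (\<phi> g p) (g p) < e / 6" if "g \<in> H" "p \<in> N" for g p
    using someI_ex[of "\<lambda>q. q \<in> M \<and> dist q (g p) < e / 6"] near[OF that] that(2)
    by (auto simp: \<phi>_def)
  have "inj_on \<phi> H"
  proof (rule inj_onI)
    fix g h assume gh: "g \<in> H" "h \<in> H" "\<phi> g = \<phi> h"
    then have G: "g \<in> G" "h \<in> G" by (auto simp: H_def)
    note iso = isom_dist[OF isomG[OF G(1)]] isom_dist[OF isomG[OF G(2)]]
    have "inv g \<circ> h = id"
    proof (rule K(3)[OF compG[OF invG[OF G(1)] G(2)]], rule ballI)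
      fix y assume "y \<in> K"
      then obtain p where p: "p \<in> N" "dist p y < e / 3" using N by auto
      have "dist (g p) (h p) < e / 3"
        using \<phi>(2)[OF gh(1) p(1)] \<phi>(2)[OF gh(2) p(1)] gh(3)
          dist_triangle[of "g p" "h p" "\<phi> g p"] by (simp add: dist_commute)
      then have "dist (g y) (h y) < e"
        using p(2) dist_triangle[of "g y" "h y" "g p"] dist_triangle[of "g p" "h y" "h p"]
        by (simp add: iso dist_commute)
      moreover have "dist (g y) (h y) = dist ((inv g \<circ> h) y) (id y)"
        using iso(1)[of y "inv g (h y)"] isom_f_inv[OF isomG[OF G(1)]] by (simp add: dist_commute)
      ultimately show "dist ((inv g \<circ> h) y) (id y) < e" by simp
    qed
    show "g = h"
    proof
      fix z
      have "inv g (h z) = z" using fun_cong[OF \<open>inv g \<circ> h = id\<close>, of z] by simp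
      then show "g z = h z" using isom_f_inv[OF isomG[OF G(1)], of "h z"] by simp
    qed
  qed
  moreover have "\<phi> ` H \<subseteq> N \<rightarrow>\<^sub>E M" using \<phi> by (auto simp: \<phi>_def)
  ultimately have "finite H" using N M by (meson finite_PiE inj_on_finite)
  then show ?thesis by (simp add: H_def)
qed

end

section \<open>The centralizer of a hyperbolic element\<close>

context hyperbolic_space
begin

text \<open>The product at \<open>x\<close> and the product of \<open>x\<close> and
  \<open>zpow g n x\<close> at \<open>zpow g i x\<close> add up to \<open>disp g x i\<close>.
  Translating the latter back to \<open>x\<close> gives a product of a forward and a backward orbit
  point, which is bounded.\<close>

lemma gromov_prod_along_powers:
  fixes g :: "'a \<Rightarrow> 'a"
  assumes g: "isom g" and l: "translation_length g > 5 * \<delta>" and i: "0 \<le> i" "i \<le> n"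
  shows "gromov_prod x (zpow g i x) (zpow g n x) \<ge> disp g x i - (disp g x 1 / 2 + 3 * \<delta>)"
proof -
  have "gromov_prod x (zpow g (n - i) x) (zpow g (- i) x) \<le> disp g x 1 / 2 + 3 * \<delta>"
    by (rule gromov_prod_opposite[OF g l]) (use i in auto)
  moreover have "dist (zpow g (n - i) x) (zpow g (- i) x) = disp g x n"
    "dist (zpow g i x) (zpow g n x) = disp g x (n - i)" "disp g x (- i) = disp g x i"
    using dist_zpow[OF g, of "n - i" x "- i"] disp_minus[OF g] dist_zpow[OF g, of i x n] by auto
  ultimately show ?thesis by (simp add: gromov_prod_def disp_def field_simps)
qed

text \<open>A translate \<open>z\<close> of \<open>g x\<close> is chosen for which \<open>x\<close>
  is almost the nearest point of its orbit; the orbits of \<open>x\<close> and \<open>z\<close> are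
  congruent because \<open>g\<close> commutes with \<open>c\<close>. Were \<open>x\<close> and
  \<open>z\<close> far apart, the quadrilateral \<open>x\<close>, \<open>z\<close>,
  \<open>zpow c m x\<close>, \<open>zpow c m z\<close> with \<open>m\<close> large would violate the
  four-point inequality. One bound serves all \<open>g\<close>, which the finiteness argument relies
  on.\<close>

lemma commuting_near_orbit:
  fixes c :: "'a \<Rightarrow> 'a"
  assumes c: "isom c" and l: "translation_length c > 6 * \<delta>"
  shows "\<exists>K. \<forall>g. isom g \<and> g \<circ> c = c \<circ> g \<longrightarrow> (\<exists>n. dist x (zpow c n (g x)) \<le> K)"
proof -
  \<comment> \<open>Minimality will hold up to this error. Half of the excess over 6\<delta> keeps
    the product of \<open>k x\<close> with \<open>zpow k m x\<close> more than \<delta> above the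
    bound \<open>A\<close> for the product of \<open>z\<close> with \<open>k x\<close>.\<close>
  define \<epsilon> where "\<epsilon> = (translation_length c - 6 * \<delta>) / 2"
  define K where "K = (disp c x 1 + \<epsilon>) / 2 + \<delta>"
  have \<epsilon>: "\<epsilon> > 0" using l by (simp add: \<epsilon>_def)
  have l4: "translation_length c > 4 * \<delta>" "translation_length c > 0" using l delta_nonneg by linarith+
  have "\<exists>n. dist x (zpow c n (g x)) \<le> 2 * K + \<delta>" if g: "isom g" and gc: "g \<circ> c = c \<circ> g" for g
  proof -
    have bdd: "bdd_below (range (\<lambda>n. dist (g x) (zpow c n x)))" by (rule bdd_belowI[of _ 0]) auto
    have "\<exists>s\<in>range (\<lambda>n. dist (g x) (zpow c n x)). s < (INF n. dist (g x) (zpow c n x)) + \<epsilon>"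
      by (subst cInf_less_iff[symmetric]) (use bdd \<epsilon> in auto)
    then obtain n where n: "dist (g x) (zpow c n x) < (INF n. dist (g x) (zpow c n x)) + \<epsilon>" by auto
    have nmin: "dist (g x) (zpow c n x) \<le> dist (g x) (zpow c m x) + \<epsilon>" for m
      using n cINF_lower[OF bdd, of m] by simp
    define z where "z = zpow c (- n) (g x)"
    have gcm: "g (zpow c m y) = zpow c m (g y)" for m y
      using fun_cong[OF zpow_commute[OF c gc, of m], of y] by simp
    have zd: "dist z (zpow c m x) = dist (g x) (zpow c (n + m) x)" for m
      using isom_dist[OF isom_zpow[OF c], of n z "zpow c m x"] zpow_add_apply[OF c, of n m x]
        zpow_add_apply[OF c, of n "- n" "g x"] by (simp add: z_def)
    have zmin: "dist z x \<le> dist z (zpow c m x) + \<epsilon>" for m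
      using nmin[of "n + m"] zd[of 0] zd[of m] by simp
    have dz: "dist z (zpow c m z) = disp c x m" for m
    proof -
      have "dist z (zpow c m z) = dist (zpow c (- n) (g x)) (zpow c (- n) (zpow c m (g x)))"
        unfolding z_def by (simp add: zpow_commute_apply[OF c])
      also have "\<dots> = dist (g x) (g (zpow c m x))"
        unfolding isom_dist[OF isom_zpow[OF c]] gcm ..
      finally show ?thesis unfolding isom_dist[OF g] disp_def .
    qed
    have side: "gromov_prod x z (zpow k m x) \<le> K"
      if k: "k = c \<or> k = inv c" and m: "m \<ge> 1" for k m
    proof -
      have ki: "isom k" "translation_length k = translation_length c" "disp k x 1 = disp c x 1"
        using k c disp_minus[OF c, of x 1]
        by (auto simp: isom_inv translation_length_inv disp_def zpow_neg_1)
      have "dist z x \<le> dist z (k x) + \<epsilon>" using k zmin[of 1] zmin[of "- 1"] by (auto simp: zpow_neg_1)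
      then have A: "gromov_prod x z (k x) \<le> (disp c x 1 + \<epsilon>) / 2"
        using ki(3) by (simp add: gromov_prod_def disp_def dist_commute)
      have "gromov_prod x (k x) (zpow k m x) \<ge> (disp c x 1 + translation_length c - 4 * \<delta>) / 2"
        using gromov_prod_same_direction[OF ki(1) _ m, of x] l4 ki by simp
      then have "gromov_prod x (zpow k m x) (k x) > (disp c x 1 + \<epsilon>) / 2 + \<delta>"
        using \<epsilon> gromov_prod_commute[of x "k x"] by (simp add: \<epsilon>_def field_simps)
      with A gromov_prod_min[of x z "zpow k m x" "k x"] show ?thesis
        by (auto simp: K_def min_def field_simps split: if_splits)
    qed
    obtain m' :: nat where m': "real m' > (2 * K + \<delta>) / translation_length c"
      using reals_Archimedean2 by blast
    define m where "m = int (Suc m')"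
    have m: "m \<ge> 1" by (simp add: m_def)
    have "real_of_int m > (2 * K + \<delta>) / translation_length c" using m' by (simp add: m_def)
    then have "real_of_int m * translation_length c > 2 * K + \<delta>" using l4 by (simp add: field_simps)
    then have fm: "disp c x m > 2 * K + \<delta>"
      using translation_length_le_disp[OF c, of m x] m by simp
    have "dist x (zpow c m z) = dist z (zpow c (- m) x)"
      using isom_dist[OF isom_zpow[OF c], of m "zpow c (- m) x" z]
        zpow_add_apply[OF c, of m "- m" x] by (simp add: dist_commute)
    moreover have "gromov_prod x z (zpow c (- m) x) \<le> K"
      using side[of "inv c" m] m by (simp add: zpow_minus[OF c])
    moreover have "gromov_prod x z (zpow c m x) \<le> K" using side[of c m] m by simp
    ultimately have "2 * (dist x z + disp c x m - 2 * K) \<le> dist z (zpow c m x) + dist x (zpow c m z)"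
      using disp_minus[OF c, of x m] by (simp add: gromov_prod_def disp_def)
    moreover have "dist z (zpow c m x) + dist x (zpow c m z)
        \<le> max (dist x z + dist x z) (disp c x m + disp c x m) + 2 * \<delta>"
      using four_point[of z "zpow c m x" x "zpow c m z"]
      by (simp add: dz isom_dist[OF isom_zpow[OF c]] disp_def dist_commute)
    ultimately have "dist x z \<le> 2 * K + \<delta>" using fm by (auto simp: max_def split: if_splits)
    then show ?thesis unfolding z_def by blast
  qed
  then show ?thesis by blast
qed

end

context discrete_isometry_group
begin

text \<open>A power of \<open>c\<close> brings every commuting \<open>g\<close> into one set of
  bounded displacement, which discreteness makes finite. Thus the powers of \<open>c\<close> have
  finite index in its centralizer.\<close>

lemma commuting_finite_cosets:
  assumes c: "c \<in> G" "translation_length c > 6 * \<delta>"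
  shows "\<exists>F. finite F \<and> F \<subseteq> G \<and>
    (\<forall>g\<in>G. g \<circ> c = c \<circ> g \<longrightarrow> (\<exists>f\<in>F. \<exists>n. g = zpow c n \<circ> f))"
proof -
  define x where "x = (undefined :: 'a)"
  obtain K where K: "\<And>g. isom g \<Longrightarrow> g \<circ> c = c \<circ> g \<Longrightarrow> \<exists>n. dist x (zpow c n (g x)) \<le> K"
    using commuting_near_orbit[OF isomG[OF c(1)] c(2)] by blast
  show ?thesis
  proof (intro exI[of _ "{g \<in> G. dist x (g x) \<le> K}"] conjI ballI impI finite_bounded_displacement)
    fix g assume g: "g \<in> G" "g \<circ> c = c \<circ> g"
    then obtain n where "dist x (zpow c n (g x)) \<le> K" using K isomG by blast
    then have "zpow c n \<circ> g \<in> {g \<in> G. dist x (g x) \<le> K}" using g zpowG c compG by auto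
    moreover have "g = zpow c (- n) \<circ> (zpow c n \<circ> g)"
      using zpow_add[OF isomG[OF c(1)], of "- n" n] by (simp flip: comp_assoc)
    ultimately show "\<exists>f\<in>{g \<in> G. dist x (g x) \<le> K}. \<exists>n. g = zpow c n \<circ> f" by blast
  qed blast
qed

lemma virtually_cyclic_of_central:
  assumes c: "c \<in> G" "translation_length c > 6 * \<delta>" and central: "\<And>g. g \<in> G \<Longrightarrow> c \<circ> g = g \<circ> c"
  shows "virtually_cyclic G"
proof -
  obtain F where F: "finite F" "F \<subseteq> G"
    "\<And>g. g \<in> G \<Longrightarrow> g \<circ> c = c \<circ> g \<Longrightarrow> \<exists>f\<in>F. \<exists>n. g = zpow c n \<circ> f"
    using commuting_finite_cosets[OF c] by blast
  have "G = (\<Union>f\<in>F. (\<lambda>h. f \<circ> h) ` range (zpow c))"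
  proof
    show "(\<Union>f\<in>F. (\<lambda>h. f \<circ> h) ` range (zpow c)) \<subseteq> G"
      using F(2) zpowG[OF c(1)] compG by blast
    show "G \<subseteq> (\<Union>f\<in>F. (\<lambda>h. f \<circ> h) ` range (zpow c))"
    proof
      fix g assume "g \<in> G"
      then obtain f n where f: "f \<in> F" "g = zpow c n \<circ> f" using F(3) central by metis
      have "zpow c n \<circ> f = f \<circ> zpow c n"
        using zpow_commute[OF isomG[OF c(1)], of f n] central f F(2) by (metis subsetD)
      then show "g \<in> (\<Union>f\<in>F. (\<lambda>h. f \<circ> h) ` range (zpow c))" using f by auto
    qed
  qed
  then show ?thesis unfolding virtually_cyclic_def using c(1) F by blast
qed

text \<open>Infinitely many exponents of \<open>g\<close> meet finitely many cosets of the powers of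
  \<open>c\<close>, and two powers in one coset differ by a power of \<open>c\<close>.\<close>

lemma commuting_power_eq:
  assumes c: "c \<in> G" "translation_length c > 6 * \<delta>" and g: "g \<in> G" "g \<circ> c = c \<circ> g"
  obtains s :: int and r :: int where "s \<ge> 1" "zpow g s = zpow c r"
proof -
  note gi = isomG[OF g(1)] and ci = isomG[OF c(1)]
  obtain F where F: "finite F" "F \<subseteq> G"
    "\<And>g. g \<in> G \<Longrightarrow> g \<circ> c = c \<circ> g \<Longrightarrow> \<exists>f\<in>F. \<exists>n. g = zpow c n \<circ> f"
    using commuting_finite_cosets[OF c] by blast
  have "\<exists>f. f \<in> F \<and> (\<exists>n. zpow g (int j) = zpow c n \<circ> f)" for j
  proof -
    have "zpow g (int j) \<circ> c = c \<circ> zpow g (int j)"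
      using zpow_commute[OF gi, of c "int j"] g(2) by simp
    then show ?thesis using F(3)[OF zpowG[OF g(1)]] by blast
  qed
  then obtain \<phi> where \<phi>: "\<And>j. \<phi> j \<in> F" "\<And>j. \<exists>n. zpow g (int j) = zpow c n \<circ> \<phi> j" by metis
  obtain i j where ij: "i < j" "\<phi> i = \<phi> j"
    using finite_range_nat_collision[OF F(1), of \<phi>] \<phi>(1) by blast
  obtain n n' where n: "zpow g (int i) = zpow c n \<circ> \<phi> i" "zpow g (int j) = zpow c n' \<circ> \<phi> i"
    using \<phi>(2) ij by metis
  have "zpow g (int j) = zpow c (n' - n) \<circ> zpow g (int i)"
    unfolding n comp_assoc[symmetric] zpow_add[OF ci, symmetric] by simp
  then have "zpow g (int j) \<circ> zpow g (- int i) = zpow c (n' - n) \<circ> (zpow g (int i) \<circ> zpow g (- int i))"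
    by (simp only: comp_assoc)
  then have "zpow g (int j - int i) = zpow c (n' - n)"
    unfolding zpow_add[OF gi, symmetric] by simp
  then show ?thesis using that[of "int j - int i" "n' - n"] ij(1) by simp
qed

text \<open>If the orbits of \<open>a\<close> and \<open>b\<close> fellow-travel forever, all conjugates \<open>a\<^sup>-\<^sup>i b a\<^sup>i\<close> displace
  \<open>y\<close> by a bounded amount, so two of them agree.\<close>
lemma commuting_power_of_unbounded_products:
  assumes a: "a \<in> G" "translation_length a > 5 * \<delta>" and b: "b \<in> G" "translation_length b > 5 * \<delta>"
    and unb: "\<And>B. \<exists>n::int. n \<ge> 1 \<and> gromov_prod y (zpow a n y) (zpow b n y) > B"
  obtains k :: int where "k \<ge> 1" "zpow a k \<circ> b = b \<circ> zpow a k"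
proof -
  note ai = isomG[OF a(1)] and bi = isomG[OF b(1)]
  define K where "K = max (disp a y 1) (disp b y 1) / 2 + 3 * \<delta>"
  define C where "C = disp b y 1 + 2 * K + 4 * \<delta>"
  have bound: "dist (zpow a (int i) y) (b (zpow a (int i) y)) \<le> 2 * C + disp b y 1" for i
  proof -
    define p where "p = zpow a (int i) y"
    have dp: "dist y p = disp a y (int i)" by (simp add: p_def disp_def)
    \<comment> \<open>So far out, the orbits still agree beyond the distance of \<open>p\<close>,
      the exponent \<open>n\<close> is at least \<open>i\<close>, and the orbit of \<open>b\<close>
      has passed that distance.\<close>
    obtain n where n: "n \<ge> 1"
      "gromov_prod y (zpow a n y) (zpow b n y) > dist y p + real i * disp a y 1"
      using unb by blast
    have na: "dist y p + real i * disp a y 1 < disp a y n"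
      using n(2) gromov_prod_le[of y "zpow a n y" "zpow b n y"] by (simp add: disp_def)
    have nb: "dist y p + real i * disp a y 1 < disp b y n"
      using n(2) gromov_prod_le[of y "zpow b n y" "zpow a n y"]
        gromov_prod_commute[of y "zpow b n y"] by (simp add: disp_def)
    have iD: "0 \<le> real i * disp a y 1" by simp
    have "real i * disp a y 1 < real (nat n) * disp a y 1"
      using na disp_of_nat_le[OF ai, of y "nat n"] n(1) zero_le_dist[of y p]
      by (simp del: zero_le_dist)
    then have "real i < real (nat n)" by (rule mult_right_less_imp_less) simp
    then have i: "int i \<le> n" by linarith
    \<comment> \<open>The point of the orbit of \<open>b\<close> matching \<open>p\<close>: the
      least exponent reaching the distance of \<open>p\<close> overshoots by at most one
      displacement, so fellow-travelling puts the two points within \<open>C\<close>.\<close>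
    define j where "j = (LEAST j. dist y p \<le> disp b y (int j))"
    have "dist y p \<le> disp b y n" using nb iD by linarith
    then have "dist y p \<le> disp b y (int (nat n))" using n(1) by simp
    then have j1: "dist y p \<le> disp b y (int j)" and j2: "j \<le> nat n"
      unfolding j_def by (rule LeastI, rule Least_le)
    have j3: "disp b y (int j) \<le> dist y p + disp b y 1"
    proof (cases j)
      case (Suc j')
      then have "disp b y (int j') < dist y p"
        using not_less_Least[of j' "\<lambda>j. dist y p \<le> disp b y (int j)"] by (simp add: j_def)
      then show ?thesis using disp_add[OF bi, of y "int j'" 1] Suc by (simp add: add.commute)
    qed simp
    define q where "q = zpow b (int j) y"
    have dq: "dist y q = disp b y (int j)" by (simp add: q_def disp_def)
    have A: "gromov_prod y p (zpow a n y) \<ge> dist y p - K"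
      using gromov_prod_along_powers[OF ai a(2), of "int i" n y] i unfolding dp
      by (simp add: K_def p_def)
    have jn: "0 \<le> int j" "int j \<le> n" using j2 n(1) by linarith+
    have Kb: "disp b y 1 / 2 + 3 * \<delta> \<le> K" by (simp add: K_def)
    have B: "gromov_prod y (zpow b n y) q \<ge> dist y p - K"
      using gromov_prod_along_powers[OF bi b(2), of "int j" n y] j1 jn Kb
        gromov_prod_commute[of y q "zpow b n y"] unfolding q_def by linarith
    have K0: "K \<ge> 0" using delta_nonneg by (simp add: K_def le_max_iff_disj)
    have M: "gromov_prod y (zpow a n y) (zpow b n y) \<ge> dist y p - K"
      using n(2) K0 iD by linarith
    have "gromov_prod y (zpow a n y) q \<ge> dist y p - K - \<delta>"
      using M B gromov_prod_min[of y "zpow a n y" "zpow b n y" q]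
      by (auto simp: min_def split: if_splits)
    then have "gromov_prod y p q \<ge> dist y p - K - 2 * \<delta>"
      using A gromov_prod_min[of y p "zpow a n y" q] delta_nonneg
      by (auto simp: min_def split: if_splits)
    then have pq: "dist p q \<le> C" using j3 dq by (simp add: gromov_prod_def C_def)
    have "dist q (b q) = disp b y 1"
      using dist_zpow[OF bi, of "int j" y "1 + int j"] zpow_add_apply[OF bi, of 1 "int j" y]
      by (simp add: q_def)
    then show ?thesis
      using pq dist_triangle[of p "b p" q] dist_triangle[of q "b p" "b q"] isom_dist[OF bi, of q p]
      unfolding p_def[symmetric] by (simp add: dist_commute)
  qed
  define h where "h i = zpow a (- int i) \<circ> b \<circ> zpow a (int i)" for i :: nat
  have "range h \<subseteq> {g \<in> G. dist y (g y) \<le> 2 * C + disp b y 1}"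
  proof
    fix g assume "g \<in> range h"
    then obtain i where g: "g = h i" by auto
    have hG: "h i \<in> G" unfolding h_def by (intro compG zpowG a(1) b(1))
    have "dist y (h i y) = dist (zpow a (int i) y) (b (zpow a (int i) y))"
      using isom_dist[OF isom_zpow[OF ai], of "int i" y "h i y"]
        zpow_add_apply[OF ai, of "int i" "- int i"] by (simp add: h_def)
    then show "g \<in> {g \<in> G. dist y (g y) \<le> 2 * C + disp b y 1}"
      using bound[of i] hG unfolding g by simp
  qed
  from finite_range_nat_collision[OF finite_bounded_displacement this]
  obtain i j where ij: "i < j" "h i = h j" .
  have "zpow a (int j - int i) (b z) = b (zpow a (int j - int i) z)" for z
  proof -
    define w where "w = zpow a (- int i) z"
    have "zpow a (int j) (h i w) = zpow a (int j) (h j w)" using ij by simp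
    then have "zpow a (int j - int i) (b (zpow a (int i) w)) = b (zpow a (int j) w)"
      unfolding h_def comp_apply zpow_add_apply[OF ai, symmetric] by simp
    then show ?thesis unfolding w_def zpow_add_apply[OF ai, symmetric] by simp
  qed
  then have "zpow a (int j - int i) \<circ> b = b \<circ> zpow a (int j - int i)" by auto
  then show ?thesis using that[of "int j - int i"] ij(1) by simp
qed

text \<open>Unbounded products with either end of \<open>a\<close> produce a commuting power, the
  backward end through \<open>inv a\<close>. Otherwise a common bound for both ends makes a
  semigroup free.\<close>

lemma free_semigroup_or_commuting_power:
  assumes a: "a \<in> G" "translation_length a > 13 * \<delta>" and b: "b \<in> G" "translation_length b > 13 * \<delta>"
  shows "free_semigroup a b \<or> free_semigroup a (inv b) \<or>
    (\<exists>k. k \<noteq> 0 \<and> zpow a k \<circ> b = b \<circ> zpow a k)"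
proof -
  note ai = isomG[OF a(1)] and bi = isomG[OF b(1)]
  define y where "y = (undefined :: 'a)"
  have l: "translation_length a > 5 * \<delta>" "translation_length b > 5 * \<delta>"
    "translation_length (inv a) > 5 * \<delta>"
    using a b delta_nonneg translation_length_inv[OF ai] by linarith+
  show ?thesis
  proof (cases "\<exists>k. k \<noteq> 0 \<and> zpow a k \<circ> b = b \<circ> zpow a k")
    case False
    have "\<not> (\<forall>B. \<exists>n::int. n \<ge> 1 \<and> gromov_prod y (zpow a n y) (zpow b n y) > B)"
    proof
      assume *: "\<forall>B. \<exists>n::int. n \<ge> 1 \<and> gromov_prod y (zpow a n y) (zpow b n y) > B"
      obtain k where "k \<ge> 1" "zpow a k \<circ> b = b \<circ> zpow a k"
        using commuting_power_of_unbounded_products[OF a(1) l(1) b(1) l(2)] * by blast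
      then have "k \<noteq> 0 \<and> zpow a k \<circ> b = b \<circ> zpow a k" by simp
      with False show False by blast
    qed
    then obtain B1 where B1: "\<And>n::int. n \<ge> 1 \<Longrightarrow> gromov_prod y (zpow a n y) (zpow b n y) \<le> B1"
      by (meson not_less)
    have "\<not> (\<forall>B. \<exists>n::int. n \<ge> 1 \<and> gromov_prod y (zpow (inv a) n y) (zpow b n y) > B)"
    proof
      assume *: "\<forall>B. \<exists>n::int. n \<ge> 1 \<and> gromov_prod y (zpow (inv a) n y) (zpow b n y) > B"
      obtain k where "k \<ge> 1" "zpow (inv a) k \<circ> b = b \<circ> zpow (inv a) k"
        using commuting_power_of_unbounded_products[OF invG[OF a(1)] l(3) b(1) l(2)] * by blast
      then have "- k \<noteq> 0 \<and> zpow a (- k) \<circ> b = b \<circ> zpow a (- k)" by (simp add: zpow_minus[OF ai])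
      with False show False by blast
    qed
    then obtain B2 where B2: "\<And>n::int. n \<ge> 1 \<Longrightarrow> gromov_prod y (zpow a (- n) y) (zpow b n y) \<le> B2"
      unfolding zpow_minus[OF ai] by (meson not_less)
    have "free_semigroup a b \<or> free_semigroup a (inv b)"
      by (rule free_semigroup_of_bounded_products[OF ai a(2) bi b(2), of y "max B1 B2"])
        (use B1 B2 in \<open>auto simp: le_max_iff_disj\<close>)
    then show ?thesis by blast
  qed blast
qed

lemma virtually_cyclic_of_commuting_power:
  assumes Gab: "G = gen_group {a, b}" and a: "isom a" and b: "isom b" "translation_length b > 13 * \<delta>"
    and s: "s \<noteq> 0" "zpow b s \<circ> a = a \<circ> zpow b s"
  shows "virtually_cyclic G"
proof (rule virtually_cyclic_of_central)
  show "zpow b s \<in> G" by (rule zpowG) (simp add: Gab gen_group.gen_gen)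
  have "1 * translation_length b \<le> \<bar>real_of_int s\<bar> * translation_length b"
    using s(1) translation_length_nonneg[OF b(1)] by (intro mult_right_mono) auto
  then show "translation_length (zpow b s) > 6 * \<delta>"
    using b delta_nonneg unfolding translation_length_zpow[OF b(1)] by linarith
  have "zpow b s \<circ> b = b \<circ> zpow b s" using zpow_commute[OF b(1) refl, of s] by simp
  then show "zpow b s \<circ> g = g \<circ> zpow b s" if "g \<in> G" for g
    using gen_group_commute[of "{a, b}" "zpow b s" g] that a b(1) s(2) Gab by blast
qed

text \<open>A power of \<open>b\<close> is conjugated by \<open>a\<close> to itself or its inverse; the latter is impossible
  because \<open>a\<^sup>2\<close> would share a power with \<open>b\<close>.\<close>
lemma virtually_cyclic_of_commuting_conjugate:
  assumes Gab: "G = gen_group {a, b}"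
    and a: "isom a" "hyperbolic_type a"
    and b: "isom b" "translation_length b > 13 * \<delta>"
    and k: "k \<noteq> 0" "zpow b k \<circ> (a \<circ> b \<circ> inv a) = (a \<circ> b \<circ> inv a) \<circ> zpow b k"
  shows "virtually_cyclic G"
proof -
  have aG: "a \<in> G" and bG: "b \<in> G" by (auto simp: Gab intro: gen_group.gen_gen)
  have lb: "translation_length b > 0" using b delta_nonneg by linarith
  have hb: "hyperbolic_type b" using lb by (simp add: hyperbolic_type_def)
  have long: "translation_length (zpow b s) > 6 * \<delta>" if "s \<noteq> 0" for s
  proof -
    have "1 * translation_length b \<le> \<bar>real_of_int s\<bar> * translation_length b"
      using that lb by (intro mult_right_mono) auto
    then show ?thesis using b delta_nonneg unfolding translation_length_zpow[OF b(1)] by linarith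
  qed
  obtain s r where s: "s \<ge> 1" and sr: "zpow (a \<circ> b \<circ> inv a) s = zpow (zpow b k) r"
    using commuting_power_eq[OF zpowG[OF bG] long[OF k(1)] compG[OF compG[OF aG bG] invG[OF aG]]] k(2)
    by metis
  define t where "t = k * r"
  have st: "a \<circ> zpow b s \<circ> inv a = zpow b t"
    using sr by (simp only: zpow_conj[OF a(1) b(1)] zpow_mult[OF b(1)] t_def)
  \<comment> \<open>Conjugation preserves translation length, which determines the exponent
    \<open>t\<close> up to sign.\<close>
  have "\<bar>real_of_int s\<bar> * translation_length b = \<bar>real_of_int t\<bar> * translation_length b"
    using arg_cong[OF st, of translation_length]
    unfolding translation_length_conj[OF a(1) isom_zpow[OF b(1)]] translation_length_zpow[OF b(1)] .
  then have "t = s \<or> t = - s" using lb s by auto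
  then show ?thesis
  proof
    assume ts: "t = s"
    have "zpow b s (a z) = a (zpow b s z)" for z
      using fun_cong[OF st, of "a z"] isom_inv_f[OF a(1)] by (simp add: ts)
    then have "zpow b s \<circ> a = a \<circ> zpow b s" by auto
    then show ?thesis using virtually_cyclic_of_commuting_power[OF Gab a(1) b, of s] s by simp
  next
    assume ts: "t = - s"
    have conj: "a (zpow b (s * m) z) = zpow b (- (s * m)) (a z)" for m z
    proof -
      have "a \<circ> zpow b (s * m) \<circ> inv a = zpow (a \<circ> zpow b s \<circ> inv a) m"
        by (simp only: zpow_conj[OF a(1) isom_zpow[OF b(1)]] zpow_mult[OF b(1)])
      also have "\<dots> = zpow b (- (s * m))" unfolding st ts by (simp add: zpow_mult[OF b(1)])
      finally have "a \<circ> zpow b (s * m) \<circ> inv a = zpow b (- (s * m))" .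
      from fun_cong[OF this, of "a z"] show ?thesis by (simp add: isom_inv_f[OF a(1)])
    qed
    have a2: "zpow a 2 z = a (a z)" for z using zpow_add_apply[OF a(1), of 1 1 z] by simp
    have "zpow a 2 \<circ> zpow b s = zpow b s \<circ> zpow a 2"
      using conj[of 1] conj[of "- 1"] by (auto simp: a2 fun_eq_iff)
    then obtain j m where j: "j \<ge> 1" and jm: "zpow (zpow a 2) j = zpow (zpow b s) m"
      using commuting_power_eq[OF zpowG[OF bG] long zpowG[OF aG], of s 2] s by (metis not_one_le_zero)
    have jm: "zpow a (2 * j) = zpow b (s * m)"
      using jm by (simp only: zpow_mult[OF a(1)] zpow_mult[OF b(1)])
    have m: "m \<noteq> 0" using hyperbolic_zpow_neq_id[OF a, of "2 * j"] j jm by auto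
    \<comment> \<open>\<open>zpow b (s * m)\<close> is a power of \<open>a\<close>, so
      \<open>a\<close> commutes with it; but \<open>a\<close> also inverts it. Its square is then
      trivial, against the hyperbolicity of \<open>b\<close>.\<close>
    have "zpow b (s * m) (a z) = zpow b (- (s * m)) (a z)" for z
      using conj[of m z] zpow_commute_apply[OF a(1), of 1 "2 * j" z] by (simp add: jm)
    then have "zpow b (s * m + s * m) (a z) = a z" for z
      using zpow_add_apply[OF b(1), of "s * m" "s * m" "a z"]
        zpow_add_apply[OF b(1), of "s * m" "- (s * m)" "a z"] by simp
    then have "zpow b (s * m + s * m) z = z" for z
      using isom_f_inv[OF a(1), of z] by metis
    then have "zpow b (s * m + s * m) = id" by auto
    then show ?thesis using hyperbolic_zpow_neq_id[OF b(1) hb, of "s * m + s * m"] m s by auto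
  qed
qed

section \<open>Free semigroups in groups that are not virtually cyclic\<close>

lemma free_semigroup_of_long_translation:
  assumes Gab: "G = gen_group {a, b}" and nvc: "\<not> virtually_cyclic G"
    and a: "isom a" "translation_length a > 13 * \<delta>" and b: "isom b" "translation_length b > 13 * \<delta>"
  shows "free_semigroup a b \<or> free_semigroup a (inv b)"
proof -
  have G: "a \<in> G" "b \<in> G" "G = gen_group {b, a}"
    by (auto simp: Gab insert_commute intro: gen_group.gen_gen)
  have "\<not> (\<exists>k. k \<noteq> 0 \<and> zpow a k \<circ> b = b \<circ> zpow a k)"
    using virtually_cyclic_of_commuting_power[OF G(3) b(1) a] nvc by blast
  then show ?thesis using free_semigroup_or_commuting_power[OF G(1) a(2) G(2) b(2)] by blast
qed

lemma free_semigroup_with_conjugate: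
  assumes Gab: "G = gen_group {a, b}" and nvc: "\<not> virtually_cyclic G"
    and a: "isom a" "hyperbolic_type a" and b: "isom b" "translation_length b > 13 * \<delta>"
  shows "free_semigroup b (a \<circ> b \<circ> inv a) \<or> free_semigroup b (a \<circ> inv b \<circ> inv a)"
proof -
  have G: "a \<in> G" "b \<in> G" by (auto simp: Gab intro: gen_group.gen_gen)
  have "inv (a \<circ> b \<circ> inv a) = inv (inv a) \<circ> (inv b \<circ> inv a)"
    by (simp only: inv_comp_isom isom_comp isom_inv a b)
  then have i: "inv (a \<circ> b \<circ> inv a) = a \<circ> inv b \<circ> inv a"
    by (simp only: inv_inv_eq isom_bij a comp_assoc)
  have "\<not> (\<exists>k. k \<noteq> 0 \<and> zpow b k \<circ> (a \<circ> b \<circ> inv a) = (a \<circ> b \<circ> inv a) \<circ> zpow b k)"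
    using virtually_cyclic_of_commuting_conjugate[OF Gab a b] nvc by blast
  moreover have "translation_length (a \<circ> b \<circ> inv a) > 13 * \<delta>"
    using b by (simp only: translation_length_conj a)
  ultimately show ?thesis
    using free_semigroup_or_commuting_power[OF G(2) b(2) compG[OF compG[OF G] invG[OF G(1)]]]
    unfolding i by blast
qed

end

theorem theorem6p9:
  fixes a b :: "'a::metric_space \<Rightarrow> 'a" and \<delta> :: real
  assumes "delta_hyperbolic TYPE('a) \<delta>"
    and "isom a" and "isom b"
    and "hyperbolic_type a" and "hyperbolic_type b"
    and "discrete_group (gen_group {a, b})"
    and "\<not> virtually_cyclic (gen_group {a, b})"
    and "margulis_const a b > 23 * \<delta>"
  shows "(translation_length a \<le> 13 * \<delta> \<and> translation_length b \<le> 13 * \<delta>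
            \<longrightarrow> freely_generates a b)
       \<and> (translation_length a > 13 * \<delta> \<and> translation_length b > 13 * \<delta>
            \<longrightarrow> free_semigroup a b \<or> free_semigroup a (inv b))
       \<and> (translation_length a \<le> 13 * \<delta> \<and> translation_length b > 13 * \<delta>
            \<longrightarrow> free_semigroup b (a \<circ> b \<circ> inv a) \<or> free_semigroup b (a \<circ> inv b \<circ> inv a))
       \<and> (translation_length a > 13 * \<delta> \<and> translation_length b \<le> 13 * \<delta>
            \<longrightarrow> free_semigroup a (b \<circ> a \<circ> inv b) \<or> free_semigroup a (b \<circ> inv a \<circ> inv b))"
proof -
  interpret hyperbolic_space \<delta> "TYPE('a)" by unfold_locales (rule assms(1))
  have S: "\<And>s. s \<in> {a, b} \<Longrightarrow> isom s" using assms(2,3) by auto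
  interpret discrete_isometry_group \<delta> "TYPE('a)" "gen_group {a, b}"
  proof
    show "isom g" "inv g \<in> gen_group {a, b}" if "g \<in> gen_group {a, b}" for g
      using gen_group_isom[of "{a, b}" g] gen_group_inv[of "{a, b}" g] S that by blast+
  qed (fact gen_group.gen_id gen_group.gen_comp assms(6))+
  \<comment> \<open>The last case is the third with \<open>a\<close> and \<open>b\<close> exchanged,
    which leaves the generated group unchanged.\<close>
  have ba: "gen_group {a, b} = gen_group {b, a}" by (simp only: insert_commute)
  show ?thesis
    using free_group_of_short_translation[OF assms(2,4) _ assms(3,5) _ assms(8)]
      free_semigroup_of_long_translation[OF refl assms(7,2) _ assms(3)]
      free_semigroup_with_conjugate[OF refl assms(7,2,4,3)]
      free_semigroup_with_conjugate[OF ba assms(7,3,5,2)]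
    by blast
qed

end
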